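(* Let $p\in[1,\infty]$, and let $E$ be an $\ell_\infty$-$V_p$-barrelled space with the sequential Gantmacher property. Then the following assertions are equivalent: (i) for every Banach space $L$, each $p$-convergent operator $T:E\to L$ is weakly compact; (ii) each $p$-convergent operator $T:E\to\ell_\infty$ is weakly compact; (iii) $E$ has the property $sV_p$.
   Context: All locally convex spaces are Hausdorff, over $\mathbb{F}\in\{\mathbb{R},\mathbb{C}\}$. An operator is a continuous linear map; $T^\ast$ is its adjoint. $E'_\beta$ is the dual $E'$ with the strong topology $\beta(E',E)$. A set in a locally convex space $F$ is relatively weakly compact if its weak closure is weakly compact, and relatively weakly sequentially compact if each sequence in it has a subsequence weakly converging to a point of $F$. An operator $T:E\to F$ is weakly compact (resp. weakly sequentially compact) if $T(U)$ is relatively weakly compact (resp. relatively weakly sequentially compact) in $F$ for some neighborhood $U$ of zero in $E$. $E$ has the sequential Gantmacher property if for every Banach space $L$, an operator $T:E\to L$ is weakly compact if and only if $T^\ast:L'_\beta\to E'_\beta$ is weakly sequentially compact. A sequence $\{x_n\}_{n\in\omega}$ in $E$ is weakly $p$-summable if $(\langle\chi,x_n\rangle)_n\in\ell_p$ (or $\in c_0$ if $p=\infty$) for every $\chi\in E'$. A linear map is $p$-convergent if it sends weakly $p$-summable sequences to null sequences. A non-empty $B\subseteq E'$ is a $p$-$(V)$ set if $\lim_n\sup_{\chi\in B}|\langle\chi,x_n\rangle|=0$ for every weakly $p$-summable sequence $\{x_n\}$ in $E$. $E$ is $\ell_\infty$-$V_p$-barrelled if every sequence in $E'$ which is (as a set)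 a $p$-$(V)$ set is equicontinuous. $E$ has the property $sV_p$ if every $p$-$(V)$ set is relatively weakly sequentially compact in $E'_\beta$. *)

theory Defs
  imports "HOL-Analysis.Analysis" "HOL-Algebra.Algebraic_Closure_Type"
begin

text \<open>
  Locally convex spaces, their duals and Banach spaces all occur as values of one record type, so
  that one can quantify over Banach spaces inside a formula and iterate the formation of duals.
  The record extends the modules of HOL-Algebra; as there, the multiplicative fields inherited from
  rings carry no meaning. The carrier need not be the whole type.

  The scalars form a type \<open>'f :: {real_normed_field, banach}\<close>. By the Gelfand-Mazur theorem,
  every such type is, as a normed field, \<open>real\<close> or \<open>complex\<close>, and both are instances.
\<close>

record ('f, 'a) tvs = "('f, 'a) module" +
  topo :: "'a topology"

definition vector_space_on ::
    "('f::{real_normed_field,banach}, 'a, 'm) module_scheme \<Rightarrow> bool" where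
  "vector_space_on V \<longleftrightarrow> Module.module (ring_of_type_algebra :: 'f ring) V"

definition convex_in ::
    "('f::{real_normed_field,banach}, 'a, 'm) module_scheme \<Rightarrow> 'a set \<Rightarrow> bool" where
  "convex_in V C \<longleftrightarrow> C \<subseteq> carrier V \<and>
     (\<forall>x\<in>C. \<forall>y\<in>C. \<forall>t\<in>{0..1}.
        (of_real t \<odot>\<^bsub>V\<^esub> x) \<oplus>\<^bsub>V\<^esub> (of_real (1 - t) \<odot>\<^bsub>V\<^esub> y) \<in> C)"

definition zero_nhd :: "('f, 'a) tvs \<Rightarrow> 'a set \<Rightarrow> bool" where
  "zero_nhd E U \<longleftrightarrow> U \<subseteq> carrier E \<and> (\<exists>V. openin (topo E) V \<and> \<zero>\<^bsub>E\<^esub> \<in> V \<and> V \<subseteq> U)"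

definition lcs :: "('f::{real_normed_field,banach}, 'a) tvs \<Rightarrow> bool" where
  "lcs E \<longleftrightarrow>
     vector_space_on E \<and>
     topspace (topo E) = carrier E \<and>
     continuous_map (prod_topology (topo E) (topo E)) (topo E) (\<lambda>(x, y). x \<oplus>\<^bsub>E\<^esub> y) \<and>
     continuous_map (prod_topology euclidean (topo E)) (topo E) (\<lambda>(c, x). c \<odot>\<^bsub>E\<^esub> x) \<and>
     Hausdorff_space (topo E) \<and>
     (\<forall>U. zero_nhd E U \<longrightarrow> (\<exists>V. zero_nhd E V \<and> convex_in E V \<and> V \<subseteq> U))"

section \<open>Banach spaces\<close>

text \<open>The value outside the carrier is fixed only because \<^locale>\<open>Metric_space\<close> asks for
  nonnegativity and symmetry on the whole type.\<close>

definition norm_dist ::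
    "('f, 'a, 'm) module_scheme \<Rightarrow> ('a \<Rightarrow> real) \<Rightarrow> 'a \<Rightarrow> 'a \<Rightarrow> real" where
  "norm_dist V N x y = (if x \<in> carrier V \<and> y \<in> carrier V then N (x \<ominus>\<^bsub>V\<^esub> y) else 0)"

definition norm_topology ::
    "('f, 'a, 'm) module_scheme \<Rightarrow> ('a \<Rightarrow> real) \<Rightarrow> 'a topology" where
  "norm_topology V N = Metric_space.mtopology (carrier V) (norm_dist V N)"

definition norm_on ::
    "('f::{real_normed_field,banach}, 'a, 'm) module_scheme \<Rightarrow> ('a \<Rightarrow> real) \<Rightarrow> bool" where
  "norm_on V N \<longleftrightarrow>
     (\<forall>x\<in>carrier V. 0 \<le> N x \<and> (N x = 0 \<longleftrightarrow> x = \<zero>\<^bsub>V\<^esub>)) \<and>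
     (\<forall>x\<in>carrier V. \<forall>y\<in>carrier V. N (x \<oplus>\<^bsub>V\<^esub> y) \<le> N x + N y) \<and>
     (\<forall>c. \<forall>x\<in>carrier V. N (c \<odot>\<^bsub>V\<^esub> x) = norm c * N x)"

definition banach_space :: "('f::{real_normed_field,banach}, 'a) tvs \<Rightarrow> ('a \<Rightarrow> real) \<Rightarrow> bool" where
  "banach_space L N \<longleftrightarrow>
     vector_space_on L \<and> norm_on L N \<and> topo L = norm_topology L N \<and>
     Metric_space.mcomplete (carrier L) (norm_dist L N)"

definition linf_module :: "('f::{real_normed_field,banach}, nat \<Rightarrow> 'f) module" where
  "linf_module =
     \<lparr>carrier = {x. bounded (range x)}, mult = undefined, one = undefined,
      zero = (\<lambda>n. 0), add = (\<lambda>x y n. x n + y n), smult = (\<lambda>c x n. c * x n)\<rparr>"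

definition linf_norm :: "(nat \<Rightarrow> 'f::{real_normed_field,banach}) \<Rightarrow> real" where
  "linf_norm x = (SUP n. norm (x n))"

definition linf :: "('f::{real_normed_field,banach}, nat \<Rightarrow> 'f) tvs" where
  "linf = module.extend linf_module \<lparr>topo = norm_topology linf_module linf_norm\<rparr>"

section \<open>Operators and duals\<close>

definition linear_op ::
    "('f::{real_normed_field,banach}, 'a) tvs \<Rightarrow> ('f, 'b) tvs \<Rightarrow> ('a \<Rightarrow> 'b) \<Rightarrow> bool" where
  "linear_op E F T \<longleftrightarrow>
     T \<in> carrier E \<rightarrow> carrier F \<and>
     (\<forall>x\<in>carrier E. \<forall>y\<in>carrier E. T (x \<oplus>\<^bsub>E\<^esub> y) = T x \<oplus>\<^bsub>F\<^esub> T y) \<and>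
     (\<forall>c. \<forall>x\<in>carrier E. T (c \<odot>\<^bsub>E\<^esub> x) = c \<odot>\<^bsub>F\<^esub> T x)"

definition operator ::
    "('f::{real_normed_field,banach}, 'a) tvs \<Rightarrow> ('f, 'b) tvs \<Rightarrow> ('a \<Rightarrow> 'b) \<Rightarrow> bool" where
  "operator E F T \<longleftrightarrow> linear_op E F T \<and> continuous_map (topo E) (topo F) T"

definition scalar_tvs :: "('f::{real_normed_field,banach}, 'f) tvs" where
  "scalar_tvs =
     \<lparr>carrier = UNIV, mult = (*), one = 1, zero = 0, add = (+), smult = (*), topo = euclidean\<rparr>"

text \<open>Functionals are normalised to be \<^const>\<open>undefined\<close> off the carrier, so that equality in
  the dual is equality as functions on the carrier.\<close>

definition dual :: "('f::{real_normed_field,banach}, 'a) tvs \<Rightarrow> ('a \<Rightarrow> 'f) set" where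
  "dual E = {\<phi> \<in> extensional (carrier E). operator E scalar_tvs \<phi>}"

definition vn_bounded :: "('f::{real_normed_field,banach}, 'a) tvs \<Rightarrow> 'a set \<Rightarrow> bool" where
  "vn_bounded E B \<longleftrightarrow> B \<subseteq> carrier E \<and>
     (\<forall>U. zero_nhd E U \<longrightarrow> (\<exists>r>0. \<forall>c::'f. norm c \<ge> r \<longrightarrow> B \<subseteq> (\<lambda>x. c \<odot>\<^bsub>E\<^esub> x) ` U))"

text \<open>The topology \<open>\<beta>(E',E)\<close> of uniform convergence on the bounded subsets of \<open>E\<close>.\<close>

definition strong_nhd ::
    "('f::{real_normed_field,banach}, 'a) tvs \<Rightarrow> ('a \<Rightarrow> 'f) \<Rightarrow> 'a set \<Rightarrow> real \<Rightarrow> ('a \<Rightarrow> 'f) set" where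
  "strong_nhd E \<phi> B \<epsilon> = {\<eta> \<in> dual E. \<forall>x\<in>B. norm (\<eta> x - \<phi> x) \<le> \<epsilon>}"

definition strong_topology ::
    "('f::{real_normed_field,banach}, 'a) tvs \<Rightarrow> ('a \<Rightarrow> 'f) topology" where
  "strong_topology E = topology (\<lambda>U. U \<subseteq> dual E \<and>
     (\<forall>\<phi>\<in>U. \<exists>B \<epsilon>. vn_bounded E B \<and> 0 < \<epsilon> \<and> strong_nhd E \<phi> B \<epsilon> \<subseteq> U))"

lemma vn_bounded_Un:
  assumes "vn_bounded E A" "vn_bounded E B"
  shows "vn_bounded E (A \<union> B)"
  unfolding vn_bounded_def
proof (intro conjI allI impI)
  show "A \<union> B \<subseteq> carrier E"
    using assms by (auto simp: vn_bounded_def)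
  fix U assume "zero_nhd E U"
  then obtain r s where "r > 0" "\<forall>c. norm c \<ge> r \<longrightarrow> A \<subseteq> (\<lambda>x. c \<odot>\<^bsub>E\<^esub> x) ` U"
    and "s > 0" "\<forall>c. norm c \<ge> s \<longrightarrow> B \<subseteq> (\<lambda>x. c \<odot>\<^bsub>E\<^esub> x) ` U"
    using assms unfolding vn_bounded_def by meson
  then have "max r s > 0" "\<forall>c. norm c \<ge> max r s \<longrightarrow> A \<union> B \<subseteq> (\<lambda>x. c \<odot>\<^bsub>E\<^esub> x) ` U"
    by simp_all
  then show "\<exists>r>0. \<forall>c. norm c \<ge> r \<longrightarrow> A \<union> B \<subseteq> (\<lambda>x. c \<odot>\<^bsub>E\<^esub> x) ` U"
    by blast
qed

lemma vn_bounded_empty: "vn_bounded E {}"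
  unfolding vn_bounded_def using zero_less_one by blast

lemma openin_strong_topology:
  "openin (strong_topology E) U \<longleftrightarrow> U \<subseteq> dual E \<and>
     (\<forall>\<phi>\<in>U. \<exists>B \<epsilon>. vn_bounded E B \<and> 0 < \<epsilon> \<and> strong_nhd E \<phi> B \<epsilon> \<subseteq> U)"
proof -
  let ?P = "\<lambda>U. U \<subseteq> dual E \<and>
     (\<forall>\<phi>\<in>U. \<exists>B \<epsilon>. vn_bounded E B \<and> 0 < \<epsilon> \<and> strong_nhd E \<phi> B \<epsilon> \<subseteq> U)"
  have "istopology ?P"
    unfolding istopology_def
  proof (rule conjI; intro allI impI)
    fix S T assume S: "?P S" and T: "?P T"
    show "?P (S \<inter> T)"
    proof (intro conjI ballI)
      show "S \<inter> T \<subseteq> dual E" using S by blast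
      fix \<phi> assume "\<phi> \<in> S \<inter> T"
      then obtain A B d e where "vn_bounded E A" "0 < d" "strong_nhd E \<phi> A d \<subseteq> S"
        and "vn_bounded E B" "0 < e" "strong_nhd E \<phi> B e \<subseteq> T"
        using S T by blast
      moreover have "strong_nhd E \<phi> (A \<union> B) (min d e) \<subseteq> strong_nhd E \<phi> A d \<inter> strong_nhd E \<phi> B e"
        by (auto simp: strong_nhd_def)
      ultimately have "vn_bounded E (A \<union> B)" "0 < min d e"
          "strong_nhd E \<phi> (A \<union> B) (min d e) \<subseteq> S \<inter> T"
        by (auto intro: vn_bounded_Un)
      then show "\<exists>B \<epsilon>. vn_bounded E B \<and> 0 < \<epsilon> \<and> strong_nhd E \<phi> B \<epsilon> \<subseteq> S \<inter> T"
        by blast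
    qed
  next
    fix \<K> assume K: "\<forall>S\<in>\<K>. ?P S"
    show "?P (\<Union>\<K>)"
    proof (intro conjI ballI)
      show "\<Union>\<K> \<subseteq> dual E" using K by blast
      fix \<phi> assume "\<phi> \<in> \<Union>\<K>"
      then obtain S where "S \<in> \<K>" "\<phi> \<in> S" by blast
      with K obtain B \<epsilon> where "vn_bounded E B" "0 < \<epsilon>" "strong_nhd E \<phi> B \<epsilon> \<subseteq> S"
        by blast
      with \<open>S \<in> \<K>\<close> show "\<exists>B \<epsilon>. vn_bounded E B \<and> 0 < \<epsilon> \<and> strong_nhd E \<phi> B \<epsilon> \<subseteq> \<Union>\<K>"
        by blast
    qed
  qed
  then show ?thesis
    by (simp add: strong_topology_def topology_inverse')
qed

lemma topspace_strong_topology: "topspace (strong_topology E) = dual E"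
proof (rule subset_antisym)
  show "topspace (strong_topology E) \<subseteq> dual E"
    by (metis openin_topspace openin_strong_topology)
  have "openin (strong_topology E) (dual E)"
    unfolding openin_strong_topology strong_nhd_def
    using vn_bounded_empty zero_less_one by blast
  then show "dual E \<subseteq> topspace (strong_topology E)"
    by (rule openin_subset)
qed

definition strong_dual ::
    "('f::{real_normed_field,banach}, 'a) tvs \<Rightarrow> ('f, 'a \<Rightarrow> 'f) tvs" where
  "strong_dual E =
     \<lparr>carrier = dual E, mult = undefined, one = undefined,
      zero = (\<lambda>x\<in>carrier E. 0),
      add = (\<lambda>\<phi> \<eta>. \<lambda>x\<in>carrier E. \<phi> x + \<eta> x),
      smult = (\<lambda>c \<phi>. \<lambda>x\<in>carrier E. c * \<phi> x),
      topo = strong_topology E\<rparr>"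

definition adjoint_op :: "('f, 'a) tvs \<Rightarrow> ('a \<Rightarrow> 'b) \<Rightarrow> ('b \<Rightarrow> 'f) \<Rightarrow> ('a \<Rightarrow> 'f)" where
  "adjoint_op E T \<phi> = (\<lambda>x\<in>carrier E. \<phi> (T x))"

definition weak_topology :: "('f::{real_normed_field,banach}, 'a) tvs \<Rightarrow> 'a topology" where
  "weak_topology F =
     topology_generated_by {{x \<in> carrier F. \<phi> x \<in> U} | \<phi> U. \<phi> \<in> dual F \<and> open U}"

section \<open>Weak compactness and the Gantmacher property\<close>

definition rel_weakly_compact ::
    "('f::{real_normed_field,banach}, 'a) tvs \<Rightarrow> 'a set \<Rightarrow> bool" where
  "rel_weakly_compact F A \<longleftrightarrow> A \<subseteq> carrier F \<and>
     compactin (weak_topology F) (weak_topology F closure_of A)"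

definition rel_weakly_seq_compact ::
    "('f::{real_normed_field,banach}, 'a) tvs \<Rightarrow> 'a set \<Rightarrow> bool" where
  "rel_weakly_seq_compact F A \<longleftrightarrow> A \<subseteq> carrier F \<and>
     (\<forall>x::nat \<Rightarrow> 'a. range x \<subseteq> A \<longrightarrow>
        (\<exists>l\<in>carrier F. \<exists>r::nat \<Rightarrow> nat. strict_mono r \<and>
           limitin (weak_topology F) (x \<circ> r) l sequentially))"

definition weakly_compact_op ::
    "('f::{real_normed_field,banach}, 'a) tvs \<Rightarrow> ('f, 'b) tvs \<Rightarrow> ('a \<Rightarrow> 'b) \<Rightarrow> bool" where
  "weakly_compact_op E F T \<longleftrightarrow>
     operator E F T \<and> (\<exists>U. zero_nhd E U \<and> rel_weakly_compact F (T ` U))"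

definition weakly_seq_compact_op ::
    "('f::{real_normed_field,banach}, 'a) tvs \<Rightarrow> ('f, 'b) tvs \<Rightarrow> ('a \<Rightarrow> 'b) \<Rightarrow> bool" where
  "weakly_seq_compact_op E F T \<longleftrightarrow>
     operator E F T \<and> (\<exists>U. zero_nhd E U \<and> rel_weakly_seq_compact F (T ` U))"

text \<open>
  HOL cannot quantify over types inside a formula, so ``every Banach space'' means every Banach
  space whose carrier lies in a type \<open>'u\<close>, to be instantiated by \<open>('f, 'a, 'l) banach_univ\<close> below.
  The type variable \<open>'l\<close> stays free in a theorem, so that a Banach space carried by any type
  whatsoever is covered, via \<^const>\<open>Inr\<close>, by some instance. Moreover each single instance is
  already exhaustive, via \<^const>\<open>Inl\<close>: the closure of the range of an operator from a space
  on \<open>'a\<close> into a Banach space consists of limits of sequences \<open>T (x n)\<close>, hence injects into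
  \<open>nat \<Rightarrow> 'a\<close>, and neither weak compactness of the operator nor weak sequential compactness of
  its adjoint changes when the codomain is replaced by this closure. The
  factor \<open>'f\<close> makes room for \<^const>\<open>linf\<close>.
\<close>

type_synonym ('f, 'a, 'l) banach_univ = "(nat \<Rightarrow> 'a \<times> 'f) + 'l"

definition seq_gantmacher ::
    "'u itself \<Rightarrow> ('f::{real_normed_field,banach}, 'a) tvs \<Rightarrow> bool" where
  "seq_gantmacher TYPE('u) E \<longleftrightarrow>
     (\<forall>(L :: ('f, 'u) tvs) N T. banach_space L N \<and> operator E L T \<longrightarrow>
        (weakly_compact_op E L T \<longleftrightarrow>
         weakly_seq_compact_op (strong_dual L) (strong_dual E) (adjoint_op E T)))"

section \<open>Weakly summable sequences and the sets and spaces they define\<close>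

definition weakly_summable ::
    "ereal \<Rightarrow> ('f::{real_normed_field,banach}, 'a) tvs \<Rightarrow> (nat \<Rightarrow> 'a) \<Rightarrow> bool" where
  "weakly_summable p E x \<longleftrightarrow> range x \<subseteq> carrier E \<and>
     (\<forall>\<phi>\<in>dual E.
        if p = \<infinity> then (\<lambda>n. \<phi> (x n)) \<longlonglongrightarrow> 0
        else summable (\<lambda>n. norm (\<phi> (x n)) powr real_of_ereal p))"

definition p_convergent ::
    "ereal \<Rightarrow> ('f::{real_normed_field,banach}, 'a) tvs \<Rightarrow> ('f, 'b) tvs \<Rightarrow> ('a \<Rightarrow> 'b) \<Rightarrow> bool" where
  "p_convergent p E F T \<longleftrightarrow> linear_op E F T \<and>
     (\<forall>x. weakly_summable p E x \<longrightarrow> limitin (topo F) (\<lambda>n. T (x n)) \<zero>\<^bsub>F\<^esub> sequentially)"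

text \<open>The supremum is taken in \<^typ>\<open>ereal\<close>, as it may be infinite.\<close>

definition p_V_set ::
    "ereal \<Rightarrow> ('f::{real_normed_field,banach}, 'a) tvs \<Rightarrow> ('a \<Rightarrow> 'f) set \<Rightarrow> bool" where
  "p_V_set p E B \<longleftrightarrow> B \<noteq> {} \<and> B \<subseteq> dual E \<and>
     (\<forall>x. weakly_summable p E x \<longrightarrow> (\<lambda>n. SUP \<phi>\<in>B. ereal (norm (\<phi> (x n)))) \<longlonglongrightarrow> 0)"

definition equicontinuous_set ::
    "('f::{real_normed_field,banach}, 'a) tvs \<Rightarrow> ('a \<Rightarrow> 'f) set \<Rightarrow> bool" where
  "equicontinuous_set E B \<longleftrightarrow>
     (\<forall>x\<in>carrier E. \<forall>\<epsilon>>0. \<exists>U. openin (topo E) U \<and> x \<in> U \<and>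
        (\<forall>y\<in>U. \<forall>\<phi>\<in>B. norm (\<phi> y - \<phi> x) < \<epsilon>))"

definition linf_Vp_barrelled ::
    "ereal \<Rightarrow> ('f::{real_normed_field,banach}, 'a) tvs \<Rightarrow> bool" where
  "linf_Vp_barrelled p E \<longleftrightarrow>
     (\<forall>\<phi>::nat \<Rightarrow> 'a \<Rightarrow> 'f. p_V_set p E (range \<phi>) \<longrightarrow> equicontinuous_set E (range \<phi>))"

definition property_sV ::
    "ereal \<Rightarrow> ('f::{real_normed_field,banach}, 'a) tvs \<Rightarrow> bool" where
  "property_sV p E \<longleftrightarrow> (\<forall>B. p_V_set p E B \<longrightarrow> rel_weakly_seq_compact (strong_dual E) B)"

end

theory Submission
  imports Defs
begin

text \<open>
  The three assertions form a cycle, and the sequential Gantmacher property is the hinge: it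
  replaces weak compactness of an operator \<open>T\<close> by weak sequential compactness of its adjoint, which
  is a statement about sets of functionals on \<open>E\<close>.

  From (iii) to (i), let \<open>T : E \<rightarrow> L\<close> be \<open>p\<close>-convergent. Every functional \<open>\<phi>\<close> in the dual unit ball of
  \<open>L\<close> satisfies \<open>|\<phi>(T x\<^sub>n)| \<le> \<parallel>T x\<^sub>n\<parallel>\<close>, so the adjoint sends that ball to a \<open>p\<close>-(V) set
  (\<open>p_V_set_adjoint_dual_ball\<close>). By (iii) this image is relatively weakly sequentially compact. The
  ball is a neighbourhood of zero in the strong dual of \<open>L\<close>, hence the adjoint is weakly
  sequentially compact, and \<open>T\<close> is weakly compact.

  From (ii) to (iii), a sequence \<open>\<xi>\<^sub>n\<close> in a \<open>p\<close>-(V) set is itself a \<open>p\<close>-(V) set, hence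
  equicontinuous by barrelledness. Therefore \<open>x \<mapsto> (\<xi>\<^sub>n x)\<^sub>n\<close> is an operator into the bounded sequences
  (\<open>operator_seq_op\<close>). The definition of a \<open>p\<close>-(V) set says exactly that it is \<open>p\<close>-convergent, because
  the supremum over the set is the sup norm of the image (\<open>p_convergent_seq_op\<close>). Its adjoint is
  therefore weakly sequentially compact. That adjoint maps the coordinate functionals, which lie
  in the dual unit ball, to the \<open>\<xi>\<^sub>n\<close>. A multiple of the ball fits into the given neighbourhood of
  zero, so the multiples \<open>c \<xi>\<^sub>n\<close> have a weakly convergent subsequence, and dividing by \<open>c\<close> gives one
  of the \<open>\<xi>\<^sub>n\<close> (\<open>weakly_compact_imp_property_sV\<close>).

  From (i) to (ii) nothing would be left to do if the bounded sequences lived in the type over which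
  the Banach spaces range. They do not, so an isometric copy of them in that type is used, here and
  wherever the Gantmacher property is applied to the space of bounded sequences. An isometry
  with inverse is a homeomorphism for the weak topologies, so weak compactness passes to the copy
  and back (\<open>weakly_compact_op_copy_iff\<close>).
\<close>

section \<open>Vector spaces and norms\<close>

locale vspace = fixes V :: "('f::{real_normed_field,banach}, 'a, 'm) module_scheme"
  assumes vector_space: "vector_space_on V"
begin

sublocale module "ring_of_type_algebra :: 'f ring" V
  using vector_space unfolding vector_space_on_def .

lemma scalar_simps [simp]:
  "carrier (ring_of_type_algebra :: 'f ring) = UNIV"
  "\<zero>\<^bsub>(ring_of_type_algebra :: 'f ring)\<^esub> = 0"
  "\<one>\<^bsub>(ring_of_type_algebra :: 'f ring)\<^esub> = 1"
  "a \<oplus>\<^bsub>(ring_of_type_algebra :: 'f ring)\<^esub> b = a + b"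
  "a \<otimes>\<^bsub>(ring_of_type_algebra :: 'f ring)\<^esub> b = a * b"
  by (simp_all add: ring_of_type_algebra_def)

lemma scale_closed: "x \<in> carrier V \<Longrightarrow> c \<odot>\<^bsub>V\<^esub> x \<in> carrier V"
  using smult_closed[of c x] by simp

lemma scale_zero: "c \<odot>\<^bsub>V\<^esub> \<zero>\<^bsub>V\<^esub> = \<zero>\<^bsub>V\<^esub>"
  using smult_r_null[of c] by simp

lemma zero_scale: "x \<in> carrier V \<Longrightarrow> 0 \<odot>\<^bsub>V\<^esub> x = \<zero>\<^bsub>V\<^esub>"
  using smult_l_null[of x] by simp

lemma scale_scale: "x \<in> carrier V \<Longrightarrow> a \<odot>\<^bsub>V\<^esub> (b \<odot>\<^bsub>V\<^esub> x) = (a * b) \<odot>\<^bsub>V\<^esub> x"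
  using smult_assoc1[of a b x] by simp

lemma one_scale: "x \<in> carrier V \<Longrightarrow> 1 \<odot>\<^bsub>V\<^esub> x = x"
  using smult_one[of x] by simp

lemma minus_eq_scale: "x \<in> carrier V \<Longrightarrow> \<ominus>\<^bsub>V\<^esub> x = (-1) \<odot>\<^bsub>V\<^esub> x"
proof -
  assume x: "x \<in> carrier V"
  have "(-1 + 1) \<odot>\<^bsub>V\<^esub> x = (-1) \<odot>\<^bsub>V\<^esub> x \<oplus>\<^bsub>V\<^esub> 1 \<odot>\<^bsub>V\<^esub> x"
    using smult_l_distr[of "-1" 1 x] x by simp
  hence "(-1) \<odot>\<^bsub>V\<^esub> x \<oplus>\<^bsub>V\<^esub> x = \<zero>\<^bsub>V\<^esub>"
    using x by (simp add: zero_scale one_scale)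
  thus ?thesis using x scale_closed[OF x, of "-1"] by (simp add: M.minus_equality)
qed

end

text \<open>
  Additive inverses come for free: \<open>(-1) x\<close> is one, by distributivity.
\<close>

lemma vector_space_onI:
  fixes V :: "('f::{real_normed_field,banach}, 'a, 'm) module_scheme"
  assumes add_closed: "\<And>x y. x \<in> carrier V \<Longrightarrow> y \<in> carrier V \<Longrightarrow> x \<oplus>\<^bsub>V\<^esub> y \<in> carrier V"
    and zero_closed: "\<zero>\<^bsub>V\<^esub> \<in> carrier V"
    and scale_closed: "\<And>c x. x \<in> carrier V \<Longrightarrow> c \<odot>\<^bsub>V\<^esub> x \<in> carrier V"
    and add_assoc: "\<And>x y z. x \<in> carrier V \<Longrightarrow> y \<in> carrier V \<Longrightarrow> z \<in> carrier V \<Longrightarrow>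
      (x \<oplus>\<^bsub>V\<^esub> y) \<oplus>\<^bsub>V\<^esub> z = x \<oplus>\<^bsub>V\<^esub> (y \<oplus>\<^bsub>V\<^esub> z)"
    and add_comm: "\<And>x y. x \<in> carrier V \<Longrightarrow> y \<in> carrier V \<Longrightarrow> x \<oplus>\<^bsub>V\<^esub> y = y \<oplus>\<^bsub>V\<^esub> x"
    and zero_add: "\<And>x. x \<in> carrier V \<Longrightarrow> \<zero>\<^bsub>V\<^esub> \<oplus>\<^bsub>V\<^esub> x = x"
    and add_scale: "\<And>a b x. x \<in> carrier V \<Longrightarrow> (a + b) \<odot>\<^bsub>V\<^esub> x = a \<odot>\<^bsub>V\<^esub> x \<oplus>\<^bsub>V\<^esub> b \<odot>\<^bsub>V\<^esub> x"
    and scale_add: "\<And>a x y. x \<in> carrier V \<Longrightarrow> y \<in> carrier V \<Longrightarrow>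
      a \<odot>\<^bsub>V\<^esub> (x \<oplus>\<^bsub>V\<^esub> y) = a \<odot>\<^bsub>V\<^esub> x \<oplus>\<^bsub>V\<^esub> a \<odot>\<^bsub>V\<^esub> y"
    and scale_scale: "\<And>a b x. x \<in> carrier V \<Longrightarrow> (a * b) \<odot>\<^bsub>V\<^esub> x = a \<odot>\<^bsub>V\<^esub> (b \<odot>\<^bsub>V\<^esub> x)"
    and one_scale: "\<And>x. x \<in> carrier V \<Longrightarrow> 1 \<odot>\<^bsub>V\<^esub> x = x"
    and zero_scale: "\<And>x. x \<in> carrier V \<Longrightarrow> 0 \<odot>\<^bsub>V\<^esub> x = \<zero>\<^bsub>V\<^esub>"
  shows "vector_space_on V"
  unfolding vector_space_on_def
proof (rule moduleI)
  show "cring (ring_of_type_algebra :: 'f ring)" by (rule cring_from_type_algebra)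
  show "abelian_group V"
  proof (rule abelian_groupI)
    show "\<exists>y\<in>carrier V. y \<oplus>\<^bsub>V\<^esub> x = \<zero>\<^bsub>V\<^esub>" if "x \<in> carrier V" for x
    proof
      show "(-1) \<odot>\<^bsub>V\<^esub> x \<in> carrier V" using that by (rule scale_closed)
      show "(-1) \<odot>\<^bsub>V\<^esub> x \<oplus>\<^bsub>V\<^esub> x = \<zero>\<^bsub>V\<^esub>"
        using add_scale[OF that, of "-1" 1] that by (simp add: one_scale zero_scale)
    qed
  qed (use assms in simp_all)
qed (use assms in \<open>simp_all add: ring_of_type_algebra_def\<close>)

locale normed_space_on = vspace V for V :: "('f::{real_normed_field,banach}, 'a, 'm) module_scheme" +
  fixes N :: "'a \<Rightarrow> real"
  assumes norm_on: "norm_on V N"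
begin

lemma norm_nonneg: "x \<in> carrier V \<Longrightarrow> 0 \<le> N x"
  and norm_eq_0: "x \<in> carrier V \<Longrightarrow> N x = 0 \<longleftrightarrow> x = \<zero>\<^bsub>V\<^esub>"
  and norm_add: "x \<in> carrier V \<Longrightarrow> y \<in> carrier V \<Longrightarrow> N (x \<oplus>\<^bsub>V\<^esub> y) \<le> N x + N y"
  and norm_scale: "x \<in> carrier V \<Longrightarrow> N (c \<odot>\<^bsub>V\<^esub> x) = norm c * N x"
  using norm_on unfolding norm_on_def by blast+

lemma norm_minus: "x \<in> carrier V \<Longrightarrow> N (\<ominus>\<^bsub>V\<^esub> x) = N x"
  by (simp add: minus_eq_scale norm_scale)

lemma dist_eq: "x \<in> carrier V \<Longrightarrow> y \<in> carrier V \<Longrightarrow> norm_dist V N x y = N (x \<ominus>\<^bsub>V\<^esub> y)"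
  by (simp add: norm_dist_def)

lemma minus_eq_zero:
  assumes "x \<in> carrier V" "y \<in> carrier V"
  shows "x \<ominus>\<^bsub>V\<^esub> y = \<zero>\<^bsub>V\<^esub> \<longleftrightarrow> x = y"
  using assms by (metis M.minus_minus M.a_inv_closed M.minus_equality M.r_neg a_minus_def)

sublocale Metric_space "carrier V" "norm_dist V N"
proof
  show "0 \<le> norm_dist V N x y" for x y
    by (simp add: norm_dist_def norm_nonneg)
  show "norm_dist V N x y = norm_dist V N y x" for x y
  proof (cases "x \<in> carrier V \<and> y \<in> carrier V")
    case True
    hence "y \<ominus>\<^bsub>V\<^esub> x = \<ominus>\<^bsub>V\<^esub> (x \<ominus>\<^bsub>V\<^esub> y)"
      by (simp add: a_minus_def M.minus_add M.a_comm)
    thus ?thesis using True by (simp add: dist_eq norm_minus)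
  qed (auto simp: norm_dist_def)
  show "norm_dist V N x y = 0 \<longleftrightarrow> x = y" if "x \<in> carrier V" "y \<in> carrier V" for x y
    using that by (simp add: dist_eq norm_eq_0 minus_eq_zero)
  show "norm_dist V N x z \<le> norm_dist V N x y + norm_dist V N y z"
    if "x \<in> carrier V" "y \<in> carrier V" "z \<in> carrier V" for x y z
  proof -
    have "x \<ominus>\<^bsub>V\<^esub> z = (x \<ominus>\<^bsub>V\<^esub> y) \<oplus>\<^bsub>V\<^esub> (y \<ominus>\<^bsub>V\<^esub> z)"
      using that by (simp add: a_minus_def M.a_assoc[symmetric] M.a_assoc[of x "\<ominus>\<^bsub>V\<^esub> y" y] M.l_neg)
    thus ?thesis using that norm_add[of "x \<ominus>\<^bsub>V\<^esub> y" "y \<ominus>\<^bsub>V\<^esub> z"] by (simp add: dist_eq)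
  qed
qed

lemma norm_topology_eq: "norm_topology V N = mtopology"
  by (simp add: norm_topology_def)

lemma dist_zero: "x \<in> carrier V \<Longrightarrow> norm_dist V N x \<zero>\<^bsub>V\<^esub> = N x"
  "x \<in> carrier V \<Longrightarrow> norm_dist V N \<zero>\<^bsub>V\<^esub> x = N x"
  by (simp_all add: dist_eq a_minus_def norm_minus minus_eq_scale[of "\<zero>\<^bsub>V\<^esub>"] scale_zero)

lemma limitin_zero_iff:
  assumes "range x \<subseteq> carrier V"
  shows "limitin (norm_topology V N) x \<zero>\<^bsub>V\<^esub> sequentially \<longleftrightarrow> (\<lambda>n. N (x n)) \<longlonglongrightarrow> 0"
proof -
  have x: "x n \<in> carrier V" for n using assms by auto
  show ?thesis
    unfolding norm_topology_eq limit_metric_sequentially LIMSEQ_def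
    using x by (simp add: dist_zero norm_nonneg)
qed

end

section \<open>Functionals and weak topologies\<close>

text \<open>
  Membership in the dual, freed from the record that turns the scalar field into a space.
\<close>

lemma dual_iff:
  "\<phi> \<in> dual E \<longleftrightarrow> \<phi> \<in> extensional (carrier E) \<and>
     (\<forall>x\<in>carrier E. \<forall>y\<in>carrier E. \<phi> (x \<oplus>\<^bsub>E\<^esub> y) = \<phi> x + \<phi> y) \<and>
     (\<forall>c. \<forall>x\<in>carrier E. \<phi> (c \<odot>\<^bsub>E\<^esub> x) = c * \<phi> x) \<and>
     continuous_map (topo E) euclidean \<phi>"
  by (auto simp: dual_def operator_def linear_op_def scalar_tvs_def)

lemma zero_functional_in_dual:
  assumes "topspace (topo E) = carrier E" and "vector_space_on E"
  shows "(\<lambda>x\<in>carrier E. 0) \<in> dual E"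
proof -
  interpret vspace E by unfold_locales fact
  have "continuous_map (topo E) euclidean (\<lambda>x\<in>carrier E. 0)"
    by (rule continuous_map_eq[where f = "\<lambda>x. 0"]) (auto simp: assms(1))
  thus ?thesis by (auto simp: dual_iff scale_closed)
qed

lemma dual_scale:
  assumes "\<phi> \<in> dual E" and "topspace (topo E) = carrier E" and "vector_space_on E"
  shows "(\<lambda>x\<in>carrier E. c * \<phi> x) \<in> dual E"
proof -
  interpret vspace E by unfold_locales fact
  have "continuous_map (topo E) euclidean ((\<lambda>z. c * z) \<circ> \<phi>)"
    using assms(1) by (intro continuous_map_compose[of _ euclidean])
      (auto simp: dual_iff intro!: continuous_intros)
  hence "continuous_map (topo E) euclidean (\<lambda>x\<in>carrier E. c * \<phi> x)"
    by (rule continuous_map_eq) (auto simp: assms(2))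
  thus ?thesis using assms(1) by (auto simp: dual_iff scale_closed algebra_simps)
qed

lemma dual_zero:
  assumes "\<phi> \<in> dual E" and "vector_space_on E"
  shows "\<phi> \<zero>\<^bsub>E\<^esub> = 0"
proof -
  interpret vspace E by unfold_locales fact
  have "\<phi> (0 \<odot>\<^bsub>E\<^esub> \<zero>\<^bsub>E\<^esub>) = 0 * \<phi> \<zero>\<^bsub>E\<^esub>"
    using assms(1) M.zero_closed unfolding dual_iff by blast
  thus ?thesis by (simp add: scale_zero)
qed

lemma topspace_weak_topology:
  assumes "dual F \<noteq> {}"
  shows "topspace (weak_topology F) = carrier F"
  using assms by (auto simp: weak_topology_def intro!: exI[of _ "carrier F"] exI[of _ UNIV])

text \<open>
  For weak continuity it suffices that composition with \<open>S\<close> sends functionals to functionals: the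
  preimage of a subbasic set given by \<open>\<phi>\<close> is the subbasic set given by \<open>\<phi> \<circ> S\<close>.
\<close>

lemma continuous_map_weak:
  assumes S: "S \<in> carrier F \<rightarrow> carrier G" and F: "dual F \<noteq> {}" and G: "dual G \<noteq> {}"
    and adj: "\<And>\<phi>. \<phi> \<in> dual G \<Longrightarrow> adjoint_op F S \<phi> \<in> dual F"
  shows "continuous_map (weak_topology F) (weak_topology G) S"
proof -
  have "continuous_map (weak_topology F)
     (topology_generated_by {{x \<in> carrier G. \<phi> x \<in> U} | \<phi> U. \<phi> \<in> dual G \<and> open U}) S"
  proof (rule continuous_on_generated_topo)
    fix W assume "W \<in> {{x \<in> carrier G. \<phi> x \<in> U} | \<phi> U. \<phi> \<in> dual G \<and> open U}"
    then obtain \<phi> U where W: "W = {x \<in> carrier G. \<phi> x \<in> U}" "\<phi> \<in> dual G" "open U" by blast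
    have eq: "S -` W \<inter> topspace (weak_topology F) = {x \<in> carrier F. adjoint_op F S \<phi> x \<in> U}"
      using S by (auto simp: W topspace_weak_topology[OF F] adjoint_op_def)
    show "openin (weak_topology F) (S -` W \<inter> topspace (weak_topology F))"
      unfolding eq unfolding weak_topology_def using adj[OF W(2)] W(3)
      by (intro topology_generated_by_Basis) blast
  next
    have "carrier G \<subseteq> topspace (weak_topology G)" using topspace_weak_topology[OF G] by simp
    thus "S ` topspace (weak_topology F) \<subseteq> \<Union> {{x \<in> carrier G. \<phi> x \<in> U} | \<phi> U. \<phi> \<in> dual G \<and> open U}"
      using S unfolding topspace_weak_topology[OF F] by (auto simp: weak_topology_def)
  qed
  thus ?thesis by (simp add: weak_topology_def)
qed

lemma adjoint_in_dual:
  assumes E: "topspace (topo E) = carrier E" "vector_space_on E" and T: "operator E F T"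
    and \<phi>: "\<phi> \<in> dual F"
  shows "adjoint_op E T \<phi> \<in> dual E"
proof -
  interpret vspace E by unfold_locales fact
  have "continuous_map (topo E) euclidean (\<phi> \<circ> T)"
    using T \<phi> by (auto simp: operator_def dual_iff intro: continuous_map_compose)
  hence "continuous_map (topo E) euclidean (adjoint_op E T \<phi>)"
    by (rule continuous_map_eq) (auto simp: E adjoint_op_def)
  thus ?thesis
    using T \<phi> by (auto simp: dual_iff adjoint_op_def operator_def linear_op_def scale_closed Pi_iff)
qed


lemma operator_comp:
  assumes "operator E F T" and "operator F G S"
  shows "operator E G (S \<circ> T)"
  using assms by (auto simp: operator_def linear_op_def Pi_iff intro: continuous_map_compose)


lemma continuous_map_weak_scale:
  assumes "topspace (topo F) = carrier F" and "vector_space_on F"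
  shows "continuous_map (weak_topology F) (weak_topology F) (\<lambda>x. c \<odot>\<^bsub>F\<^esub> x)"
proof (rule continuous_map_weak)
  interpret vspace F by unfold_locales fact
  show "(\<lambda>x. c \<odot>\<^bsub>F\<^esub> x) \<in> carrier F \<rightarrow> carrier F" by (auto simp: scale_closed)
  show "dual F \<noteq> {}" "dual F \<noteq> {}" using zero_functional_in_dual[OF assms] by blast+
  show "adjoint_op F (\<lambda>x. c \<odot>\<^bsub>F\<^esub> x) \<phi> \<in> dual F" if "\<phi> \<in> dual F" for \<phi>
  proof -
    have "adjoint_op F (\<lambda>x. c \<odot>\<^bsub>F\<^esub> x) \<phi> = (\<lambda>x\<in>carrier F. c * \<phi> x)"
      using that by (auto simp: adjoint_op_def dual_iff)
    thus ?thesis using dual_scale[OF that assms] by simp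
  qed
qed


text \<open>
  An invertible operator is a homeomorphism for the weak topologies, hence commutes with
  weak closures. For a general operator one would need the weakly compact image of the closure to
  be weakly closed, thus a Hausdorff weak topology, which rests on the Hahn-Banach theorem; the
  inverse makes this superfluous.
\<close>

lemma weakly_compact_op_comp_iso:
  assumes T: "weakly_compact_op E F T" and J: "operator F G J" and R: "operator G F R"
    and RJ: "\<And>x. x \<in> carrier F \<Longrightarrow> R (J x) = x" and JR: "\<And>y. y \<in> carrier G \<Longrightarrow> J (R y) = y"
    and F: "topspace (topo F) = carrier F" "vector_space_on F"
    and G: "topspace (topo G) = carrier G" "vector_space_on G"
  shows "weakly_compact_op E G (J \<circ> T)"
proof -
  have F0: "dual F \<noteq> {}" using zero_functional_in_dual[OF F] by blast
  have G0: "dual G \<noteq> {}" using zero_functional_in_dual[OF G] by blast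
  have JFG: "J \<in> carrier F \<rightarrow> carrier G" and RGF: "R \<in> carrier G \<rightarrow> carrier F"
    using J R by (auto simp: operator_def linear_op_def)
  have "continuous_map (weak_topology F) (weak_topology G) J"
    by (rule continuous_map_weak[OF JFG F0 G0 adjoint_in_dual[OF F J]])
  moreover have "continuous_map (weak_topology G) (weak_topology F) R"
    by (rule continuous_map_weak[OF RGF G0 F0 adjoint_in_dual[OF G R]])
  ultimately have hm: "homeomorphic_maps (weak_topology F) (weak_topology G) J R"
    using RJ JR by (simp add: homeomorphic_maps_def topspace_weak_topology F0 G0)
  obtain U where U: "zero_nhd E U" "rel_weakly_compact F (T ` U)" and TE: "operator E F T"
    using T by (auto simp: weakly_compact_op_def)
  let ?K = "weak_topology F closure_of (T ` U)"
  have TU: "T ` U \<subseteq> carrier F" and K: "compactin (weak_topology F) ?K"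
    using U(2) by (auto simp: rel_weakly_compact_def)
  have "weak_topology G closure_of (J ` T ` U) = J ` ?K"
    using homeomorphic_maps_imp_map[OF hm] TU
    by (simp add: homeomorphic_map_closure_of topspace_weak_topology[OF F0])
  moreover have "compactin (weak_topology G) (J ` ?K)"
    using hm by (intro image_compactin[OF K]) (simp add: homeomorphic_maps_def)
  ultimately have "rel_weakly_compact G ((J \<circ> T) ` U)"
    using TU JFG by (auto simp: rel_weakly_compact_def image_comp Pi_iff)
  thus ?thesis using U(1) operator_comp[OF TE J] by (auto simp: weakly_compact_op_def)
qed


text \<open>
  Only a multiple of the sequence of interest is known to lie in a good set; since multiplication
  by the inverse scalar is weakly continuous, convergence of the multiples is enough.
\<close>

lemma rel_weakly_seq_compact_unscale:
  fixes F :: "('f::{real_normed_field,banach}, 'a) tvs"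
  assumes F: "topspace (topo F) = carrier F" "vector_space_on F"
    and A: "rel_weakly_seq_compact F A" and c: "c \<noteq> 0"
    and x: "\<And>n. x n \<in> carrier F" "\<And>n. c \<odot>\<^bsub>F\<^esub> x n \<in> A"
  shows "\<exists>l\<in>carrier F. \<exists>r::nat \<Rightarrow> nat. strict_mono r \<and>
           limitin (weak_topology F) (x \<circ> r) l sequentially"
proof -
  interpret vspace F by unfold_locales fact
  have "range (\<lambda>n. c \<odot>\<^bsub>F\<^esub> x n) \<subseteq> A" using x(2) by blast
  with A obtain l r where l: "l \<in> carrier F" and r: "strict_mono (r :: nat \<Rightarrow> nat)"
    and lim: "limitin (weak_topology F) ((\<lambda>n. c \<odot>\<^bsub>F\<^esub> x n) \<circ> r) l sequentially"
    unfolding rel_weakly_seq_compact_def by blast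
  have "limitin (weak_topology F) ((\<lambda>y. inverse c \<odot>\<^bsub>F\<^esub> y) \<circ> ((\<lambda>n. c \<odot>\<^bsub>F\<^esub> x n) \<circ> r))
      (inverse c \<odot>\<^bsub>F\<^esub> l) sequentially"
    by (rule continuous_map_limit[OF continuous_map_weak_scale[OF F] lim])
  moreover have "(\<lambda>y. inverse c \<odot>\<^bsub>F\<^esub> y) \<circ> ((\<lambda>n. c \<odot>\<^bsub>F\<^esub> x n) \<circ> r) = x \<circ> r"
    using c x(1) by (simp add: fun_eq_iff scale_scale one_scale)
  ultimately show ?thesis using r scale_closed[OF l] by metis
qed

section \<open>Strong duals and adjoints\<close>

lemma strong_dual_simps [simp]:
  "carrier (strong_dual E) = dual E"
  "\<zero>\<^bsub>strong_dual E\<^esub> = (\<lambda>x\<in>carrier E. 0)"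
  "\<phi> \<oplus>\<^bsub>strong_dual E\<^esub> \<eta> = (\<lambda>x\<in>carrier E. \<phi> x + \<eta> x)"
  "c \<odot>\<^bsub>strong_dual E\<^esub> \<phi> = (\<lambda>x\<in>carrier E. c * \<phi> x)"
  "topo (strong_dual E) = strong_topology E"
  by (simp_all add: strong_dual_def)

lemma dual_add:
  assumes "\<phi> \<in> dual E" and "\<eta> \<in> dual E"
    and "topspace (topo E) = carrier E" and "vector_space_on E"
  shows "(\<lambda>x\<in>carrier E. \<phi> x + \<eta> x) \<in> dual E"
proof -
  interpret vspace E by unfold_locales fact
  have "continuous_map (topo E) euclidean (\<lambda>x. \<phi> x + \<eta> x)"
    using assms(1,2) by (intro continuous_map_add) (auto simp: dual_iff)
  hence "continuous_map (topo E) euclidean (\<lambda>x\<in>carrier E. \<phi> x + \<eta> x)"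
    by (rule continuous_map_eq) (auto simp: assms(3))
  thus ?thesis using assms(1,2) by (auto simp: dual_iff scale_closed algebra_simps)
qed

lemma vector_space_on_strong_dual:
  assumes "topspace (topo E) = carrier E" and "vector_space_on E"
  shows "vector_space_on (strong_dual E)"
proof -
  have undef: "\<phi> x = undefined" if "\<phi> \<in> dual E" "x \<notin> carrier E" for \<phi> x
    using that by (auto simp: dual_iff extensional_def)
  show ?thesis
  proof (rule vector_space_onI)
    show "\<phi> \<oplus>\<^bsub>strong_dual E\<^esub> \<eta> \<in> carrier (strong_dual E)"
      if "\<phi> \<in> carrier (strong_dual E)" "\<eta> \<in> carrier (strong_dual E)" for \<phi> \<eta>
      using that by (simp add: dual_add[OF _ _ assms])
    show "\<zero>\<^bsub>strong_dual E\<^esub> \<in> carrier (strong_dual E)"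
      using zero_functional_in_dual[OF assms] by simp
    show "c \<odot>\<^bsub>strong_dual E\<^esub> \<phi> \<in> carrier (strong_dual E)"
      if "\<phi> \<in> carrier (strong_dual E)" for c \<phi>
      using that by (simp add: dual_scale[OF _ assms])
  qed (auto simp: fun_eq_iff algebra_simps undef)
qed

text \<open>
  The sets \<open>strong_nhd\<close> are defined by a non-strict inequality and need not be open, so that they are
  neighbourhoods of zero has to be shown.
\<close>

lemma zero_nhd_strong_dual_iff:
  assumes "topspace (topo E) = carrier E" and "vector_space_on E"
  shows "zero_nhd (strong_dual E) U \<longleftrightarrow> U \<subseteq> dual E \<and>
    (\<exists>B \<epsilon>. vn_bounded E B \<and> 0 < \<epsilon> \<and> strong_nhd E (\<lambda>x\<in>carrier E. 0) B \<epsilon> \<subseteq> U)"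
proof
  assume "zero_nhd (strong_dual E) U"
  thus "U \<subseteq> dual E \<and>
    (\<exists>B \<epsilon>. vn_bounded E B \<and> 0 < \<epsilon> \<and> strong_nhd E (\<lambda>x\<in>carrier E. 0) B \<epsilon> \<subseteq> U)"
    unfolding zero_nhd_def strong_dual_simps openin_strong_topology by (meson order_trans)
next
  assume "U \<subseteq> dual E \<and>
    (\<exists>B \<epsilon>. vn_bounded E B \<and> 0 < \<epsilon> \<and> strong_nhd E (\<lambda>x\<in>carrier E. 0) B \<epsilon> \<subseteq> U)"
  then obtain B \<epsilon> where U: "U \<subseteq> dual E" and B: "vn_bounded E B" and \<epsilon>: "0 < \<epsilon>"
    and sub: "strong_nhd E (\<lambda>x\<in>carrier E. 0) B \<epsilon> \<subseteq> U" by blast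
  have BE: "B \<subseteq> carrier E" using B by (simp add: vn_bounded_def)
  \<comment> \<open>Bounds uniformly below \<open>\<epsilon>\<close> leave room to move, which makes \<open>V\<close> open.\<close>
  define V where "V = {\<phi> \<in> dual E. \<exists>\<delta><\<epsilon>. \<forall>x\<in>B. norm (\<phi> x) \<le> \<delta>}"
  have "openin (strong_topology E) V"
    unfolding openin_strong_topology
  proof (intro conjI ballI)
    show "V \<subseteq> dual E" by (auto simp: V_def)
    fix \<phi> assume "\<phi> \<in> V"
    then obtain \<delta> where \<delta>: "\<delta> < \<epsilon>" "\<forall>x\<in>B. norm (\<phi> x) \<le> \<delta>" by (auto simp: V_def)
    have "strong_nhd E \<phi> B ((\<epsilon> - \<delta>) / 2) \<subseteq> V"
    proof
      fix \<eta> assume \<eta>: "\<eta> \<in> strong_nhd E \<phi> B ((\<epsilon> - \<delta>) / 2)"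
      have "norm (\<eta> x) \<le> (\<epsilon> + \<delta>) / 2" if "x \<in> B" for x
      proof -
        have "norm (\<eta> x) \<le> norm (\<eta> x - \<phi> x) + norm (\<phi> x)"
          by (metis diff_add_cancel norm_triangle_ineq)
        also have "\<dots> \<le> (\<epsilon> - \<delta>) / 2 + \<delta>"
          using \<eta> \<delta>(2) that by (intro add_mono) (auto simp: strong_nhd_def)
        finally show ?thesis by (simp add: field_simps)
      qed
      moreover have "(\<epsilon> + \<delta>) / 2 < \<epsilon>" using \<delta>(1) by simp
      ultimately show "\<eta> \<in> V" using \<eta> unfolding V_def strong_nhd_def by blast
    qed
    thus "\<exists>B \<epsilon>. vn_bounded E B \<and> 0 < \<epsilon> \<and> strong_nhd E \<phi> B \<epsilon> \<subseteq> V"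
      using B \<delta>(1) by (intro exI[of _ B] exI[of _ "(\<epsilon> - \<delta>) / 2"]) auto
  qed
  moreover have "(\<lambda>x\<in>carrier E. 0) \<in> V"
    using zero_functional_in_dual[OF assms] \<epsilon> BE unfolding V_def
    by (auto intro!: exI[of _ 0])
  moreover have "V \<subseteq> strong_nhd E (\<lambda>x\<in>carrier E. 0) B \<epsilon>"
    using BE unfolding V_def strong_nhd_def by fastforce
  ultimately show "zero_nhd (strong_dual E) U"
    using U sub unfolding zero_nhd_def by auto
qed

lemma linear_op_zero:
  assumes "linear_op E F T" and "vector_space_on E" and "vector_space_on F"
  shows "T \<zero>\<^bsub>E\<^esub> = \<zero>\<^bsub>F\<^esub>"
proof -
  interpret E: vspace E by unfold_locales fact
  interpret F: vspace F by unfold_locales fact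
  have "T (0 \<odot>\<^bsub>E\<^esub> \<zero>\<^bsub>E\<^esub>) = 0 \<odot>\<^bsub>F\<^esub> T \<zero>\<^bsub>E\<^esub>"
    using assms(1) E.M.zero_closed unfolding linear_op_def by blast
  moreover have "T \<zero>\<^bsub>E\<^esub> \<in> carrier F"
    using assms(1) E.M.zero_closed unfolding linear_op_def by blast
  ultimately show ?thesis by (simp add: E.scale_zero F.zero_scale)
qed

lemma vn_bounded_image:
  assumes T: "operator E F T" and E: "topspace (topo E) = carrier E" "vector_space_on E"
    and F: "vector_space_on F" and B: "vn_bounded E B"
  shows "vn_bounded F (T ` B)"
  unfolding vn_bounded_def
proof (intro conjI allI impI)
  interpret E: vspace E by unfold_locales fact
  have lin: "linear_op E F T" using T by (simp add: operator_def)
  show "T ` B \<subseteq> carrier F" using B lin by (auto simp: vn_bounded_def linear_op_def)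
  fix U assume "zero_nhd F U"
  then obtain V where V: "openin (topo F) V" "\<zero>\<^bsub>F\<^esub> \<in> V" "V \<subseteq> U"
    by (auto simp: zero_nhd_def)
  let ?W = "{x \<in> carrier E. T x \<in> V}"
  have "openin (topo E) ?W"
    using openin_continuous_map_preimage[of "topo E" "topo F" T V] T V(1) E(1)
    by (simp add: operator_def)
  moreover have "\<zero>\<^bsub>E\<^esub> \<in> ?W"
    using V(2) linear_op_zero[OF lin E(2) F] E.M.zero_closed by simp
  ultimately have "zero_nhd E ?W" unfolding zero_nhd_def by blast
  then obtain r where r: "r > 0" "\<forall>c. norm c \<ge> r \<longrightarrow> B \<subseteq> (\<lambda>x. c \<odot>\<^bsub>E\<^esub> x) ` ?W"
    using B unfolding vn_bounded_def by blast
  have "T ` B \<subseteq> (\<lambda>x. c \<odot>\<^bsub>F\<^esub> x) ` U" if "norm c \<ge> r" for c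
  proof
    fix z assume "z \<in> T ` B"
    then obtain x where x: "x \<in> B" "z = T x" by blast
    with r(2) that obtain w where "w \<in> ?W" "x = c \<odot>\<^bsub>E\<^esub> w" by blast
    thus "z \<in> (\<lambda>x. c \<odot>\<^bsub>F\<^esub> x) ` U"
      using V(3) lin x(2) by (auto simp: linear_op_def)
  qed
  with r(1) show "\<exists>r>0. \<forall>c. r \<le> norm c \<longrightarrow> T ` B \<subseteq> (\<lambda>x. c \<odot>\<^bsub>F\<^esub> x) ` U" by blast
qed

lemma operator_adjoint:
  assumes T: "operator E F T" and E: "topspace (topo E) = carrier E" "vector_space_on E"
    and F: "topspace (topo F) = carrier F" "vector_space_on F"
  shows "operator (strong_dual F) (strong_dual E) (adjoint_op E T)"
  unfolding operator_def
proof
  have TF: "T x \<in> carrier F" if "x \<in> carrier E" for x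
    using T that by (auto simp: operator_def linear_op_def)
  show "linear_op (strong_dual F) (strong_dual E) (adjoint_op E T)"
    unfolding linear_op_def using adjoint_in_dual[OF E T] TF
    by (auto simp: adjoint_op_def fun_eq_iff)
  show "continuous_map (topo (strong_dual F)) (topo (strong_dual E)) (adjoint_op E T)"
    unfolding continuous_map_def strong_dual_simps topspace_strong_topology
  proof (intro conjI allI impI)
    show "adjoint_op E T \<in> dual F \<rightarrow> dual E" using adjoint_in_dual[OF E T] by blast
    fix U assume U: "openin (strong_topology E) U"
    show "openin (strong_topology F) {\<phi> \<in> dual F. adjoint_op E T \<phi> \<in> U}"
      unfolding openin_strong_topology
    proof (intro conjI ballI)
      fix \<phi> assume "\<phi> \<in> {\<phi> \<in> dual F. adjoint_op E T \<phi> \<in> U}"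
      then obtain B \<epsilon> where B: "vn_bounded E B" "0 < \<epsilon>" "strong_nhd E (adjoint_op E T \<phi>) B \<epsilon> \<subseteq> U"
        using U unfolding openin_strong_topology by blast
      have "B \<subseteq> carrier E" using B(1) by (simp add: vn_bounded_def)
      hence "strong_nhd F \<phi> (T ` B) \<epsilon> \<subseteq> {\<phi> \<in> dual F. adjoint_op E T \<phi> \<in> U}"
        using B(3) adjoint_in_dual[OF E T] by (auto simp: strong_nhd_def adjoint_op_def subset_iff)
      thus "\<exists>B \<epsilon>. vn_bounded F B \<and> 0 < \<epsilon> \<and>
          strong_nhd F \<phi> B \<epsilon> \<subseteq> {\<phi> \<in> dual F. adjoint_op E T \<phi> \<in> U}"
        using vn_bounded_image[OF T E F(2) B(1)] B(2) by blast
    qed auto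
  qed
qed

lemma p_convergent_comp:
  assumes T: "p_convergent p E F T" and S: "operator F G S"
    and "vector_space_on F" "vector_space_on G"
  shows "p_convergent p E G (S \<circ> T)"
  unfolding p_convergent_def
proof (intro conjI allI impI)
  show "linear_op E G (S \<circ> T)"
    using T S by (auto simp: p_convergent_def operator_def linear_op_def Pi_iff)
  fix x assume "weakly_summable p E x"
  hence "limitin (topo F) (\<lambda>n. T (x n)) \<zero>\<^bsub>F\<^esub> sequentially" using T by (simp add: p_convergent_def)
  moreover have "continuous_map (topo F) (topo G) S" and "S \<zero>\<^bsub>F\<^esub> = \<zero>\<^bsub>G\<^esub>"
    using S linear_op_zero[of F G S] assms(3,4) by (auto simp: operator_def)
  ultimately show "limitin (topo G) (\<lambda>n. (S \<circ> T) (x n)) \<zero>\<^bsub>G\<^esub> sequentially"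
    using continuous_map_limit[of "topo F" "topo G" S "\<lambda>n. T (x n)" "\<zero>\<^bsub>F\<^esub>"] by (simp add: o_def)
qed


section \<open>Banach spaces\<close>

locale normed_tvs = normed_space_on L N for L :: "('f::{real_normed_field,banach}, 'a) tvs" and N +
  assumes topo_eq: "topo L = norm_topology L N"
begin

lemma topspace_eq: "topspace (topo L) = carrier L"
  by (simp add: topo_eq norm_topology_eq)

text \<open>
  The multiples of the unit ball form a base of neighbourhoods of zero, so being absorbed by all
  neighbourhoods means being absorbed by the ball.
\<close>

lemma vn_bounded_iff:
  "vn_bounded L B \<longleftrightarrow> B \<subseteq> carrier L \<and> (\<exists>M. \<forall>x\<in>B. N x \<le> M)"
proof
  assume B: "vn_bounded L B"
  let ?U = "mball \<zero>\<^bsub>L\<^esub> 1"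
  have "zero_nhd L ?U"
    unfolding zero_nhd_def topo_eq norm_topology_eq
    by (intro conjI exI[of _ ?U]) (auto simp: openin_mball)
  then obtain r where r: "r > 0" "\<forall>c::'f. norm c \<ge> r \<longrightarrow> B \<subseteq> (\<lambda>x. c \<odot>\<^bsub>L\<^esub> x) ` ?U"
    using B unfolding vn_bounded_def by blast
  have "B \<subseteq> (\<lambda>x. (of_real r::'f) \<odot>\<^bsub>L\<^esub> x) ` ?U" using r by simp
  hence "\<forall>x\<in>B. N x \<le> r"
    using r(1) by (fastforce simp: norm_scale dist_zero mult_le_cancel_left1)
  thus "B \<subseteq> carrier L \<and> (\<exists>M. \<forall>x\<in>B. N x \<le> M)" using B by (auto simp: vn_bounded_def)
next
  assume "B \<subseteq> carrier L \<and> (\<exists>M. \<forall>x\<in>B. N x \<le> M)"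
  then obtain M where BL: "B \<subseteq> carrier L" and M: "\<forall>x\<in>B. N x \<le> M" by blast
  show "vn_bounded L B"
    unfolding vn_bounded_def
  proof (intro conjI allI impI BL)
    fix U assume "zero_nhd L U"
    then obtain V where V: "openin mtopology V" "\<zero>\<^bsub>L\<^esub> \<in> V" "V \<subseteq> U"
      by (auto simp: zero_nhd_def topo_eq norm_topology_eq)
    then obtain \<delta> where \<delta>: "\<delta> > 0" "mball \<zero>\<^bsub>L\<^esub> \<delta> \<subseteq> V" unfolding openin_mtopology by blast
    define r where "r = (\<bar>M\<bar> + 1) / \<delta>"
    have r: "r > 0" using \<delta>(1) by (simp add: r_def)
    have "B \<subseteq> (\<lambda>x. c \<odot>\<^bsub>L\<^esub> x) ` U" if c: "r \<le> norm c" for c :: 'f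
    proof
      fix x assume x: "x \<in> B"
      have xL: "x \<in> carrier L" using x BL by blast
      have c0: "c \<noteq> 0" using c r by auto
      have "N x < r * \<delta>" using M x \<delta>(1) by (force simp: r_def)
      also have "\<dots> \<le> norm c * \<delta>" using c \<delta>(1) by simp
      finally have "N (inverse c \<odot>\<^bsub>L\<^esub> x) < \<delta>"
        using c0 xL by (simp add: norm_scale norm_inverse norm_divide field_simps)
      hence "inverse c \<odot>\<^bsub>L\<^esub> x \<in> mball \<zero>\<^bsub>L\<^esub> \<delta>"
        using xL by (simp add: dist_zero scale_closed)
      hence "inverse c \<odot>\<^bsub>L\<^esub> x \<in> U" using \<delta>(2) V(3) by blast
      moreover have "x = c \<odot>\<^bsub>L\<^esub> (inverse c \<odot>\<^bsub>L\<^esub> x)"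
        using c0 xL by (simp add: scale_scale one_scale)
      ultimately show "x \<in> (\<lambda>x. c \<odot>\<^bsub>L\<^esub> x) ` U" by blast
    qed
    with r show "\<exists>r>0. \<forall>c::'f. r \<le> norm c \<longrightarrow> B \<subseteq> (\<lambda>x. c \<odot>\<^bsub>L\<^esub> x) ` U" by blast
  qed
qed

text \<open>
  The unit ball of the dual; comparing with \<open>N x\<close> for all \<open>x\<close> avoids dividing by the norm later.
\<close>

definition dual_ball :: "('a \<Rightarrow> 'f) set" where
  "dual_ball = {\<phi> \<in> dual L. \<forall>x\<in>carrier L. norm (\<phi> x) \<le> N x}"

text \<open>
  The polar of the unit ball of \<open>L\<close>, a bounded set, is contained in the dual ball by homogeneity.
\<close>

lemma zero_nhd_dual_ball: "zero_nhd (strong_dual L) dual_ball"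
  unfolding zero_nhd_strong_dual_iff[OF topspace_eq vector_space]
proof (intro conjI exI)
  let ?B = "{x \<in> carrier L. N x \<le> 1}"
  show "vn_bounded L ?B" unfolding vn_bounded_iff by blast
  show "(0::real) < 1" by simp
  show "strong_nhd L (\<lambda>x\<in>carrier L. 0) ?B 1 \<subseteq> dual_ball"
  proof
    fix \<phi> assume \<phi>: "\<phi> \<in> strong_nhd L (\<lambda>x\<in>carrier L. 0) ?B 1"
    hence \<phi>L: "\<phi> \<in> dual L" and le1: "\<And>x. x \<in> carrier L \<Longrightarrow> N x \<le> 1 \<Longrightarrow> norm (\<phi> x) \<le> 1"
      by (auto simp: strong_nhd_def)
    have "norm (\<phi> x) \<le> N x" if x: "x \<in> carrier L" for x
    proof (cases "N x = 0")
      case True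
      thus ?thesis using x dual_zero[OF \<phi>L vector_space] norm_nonneg[OF x] by (simp add: norm_eq_0)
    next
      case False
      hence pos: "N x > 0" using norm_nonneg[OF x] by simp
      have "norm (\<phi> (of_real (inverse (N x)) \<odot>\<^bsub>L\<^esub> x)) \<le> 1"
        using pos by (intro le1) (simp_all add: scale_closed x norm_scale norm_inverse)
      thus ?thesis using \<phi>L x pos by (simp add: dual_iff norm_mult norm_divide field_simps)
    qed
    thus "\<phi> \<in> dual_ball" using \<phi>L by (simp add: dual_ball_def)
  qed
qed (simp add: dual_ball_def)

text \<open>
  The dual ball is bounded for the strong topology: on a set where the norm is at most \<open>M\<close>, the
  functionals of the ball are at most \<open>M\<close> too.
\<close>

lemma dual_ball_scale_in_zero_nhd:
  assumes "zero_nhd (strong_dual L) U"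
  shows "\<exists>c. c \<noteq> 0 \<and> (\<forall>\<phi>\<in>dual_ball. (\<lambda>x\<in>carrier L. c * \<phi> x) \<in> U)"
proof -
  obtain B e where B: "vn_bounded L B" and e: "0 < e"
    and sub: "strong_nhd L (\<lambda>x\<in>carrier L. 0) B e \<subseteq> U"
    using assms unfolding zero_nhd_strong_dual_iff[OF topspace_eq vector_space] by blast
  obtain M where BL: "B \<subseteq> carrier L" and M: "\<forall>x\<in>B. N x \<le> M"
    using B unfolding vn_bounded_iff by blast
  \<comment> \<open>The summand 1 keeps the denominator positive when \<open>M\<close> is zero.\<close>
  define d where "d = e / (\<bar>M\<bar> + 1)"
  have d: "d > 0" and dM: "d * \<bar>M\<bar> \<le> e" using e by (auto simp: d_def field_simps)
  have "(\<lambda>x\<in>carrier L. of_real d * \<phi> x) \<in> U" if \<phi>: "\<phi> \<in> dual_ball" for \<phi>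
  proof -
    have "norm (of_real d * \<phi> x) \<le> e" if x: "x \<in> B" for x
    proof -
      have "norm (\<phi> x) \<le> N x" using \<phi> x BL by (auto simp: dual_ball_def)
      also have "N x \<le> \<bar>M\<bar>" using M x by force
      finally have "d * norm (\<phi> x) \<le> d * \<bar>M\<bar>" by (rule mult_left_mono) (use d in simp)
      also note dM
      finally show ?thesis using d by (simp add: norm_mult)
    qed
    hence "(\<lambda>x\<in>carrier L. of_real d * \<phi> x) \<in> strong_nhd L (\<lambda>x\<in>carrier L. 0) B e"
      using dual_scale[OF _ topspace_eq vector_space] \<phi> BL
      by (auto simp: strong_nhd_def dual_ball_def)
    thus ?thesis using sub by blast
  qed
  thus ?thesis using d by (intro exI[of _ "of_real d"]) auto
qed

lemma dual_if_bounded: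
  assumes "\<phi> \<in> extensional (carrier L)"
    and add: "\<And>x y. x \<in> carrier L \<Longrightarrow> y \<in> carrier L \<Longrightarrow> \<phi> (x \<oplus>\<^bsub>L\<^esub> y) = \<phi> x + \<phi> y"
    and scale: "\<And>c x. x \<in> carrier L \<Longrightarrow> \<phi> (c \<odot>\<^bsub>L\<^esub> x) = c * \<phi> x"
    and bound: "\<And>x. x \<in> carrier L \<Longrightarrow> norm (\<phi> x) \<le> N x"
  shows "\<phi> \<in> dual L"
proof -
  have diff: "\<phi> (x \<ominus>\<^bsub>L\<^esub> y) = \<phi> x - \<phi> y" if "x \<in> carrier L" "y \<in> carrier L" for x y
    using that by (simp add: a_minus_def minus_eq_scale add scale scale_closed)
  have lip: "dist (\<phi> x) (\<phi> y) \<le> norm_dist L N x y" if "x \<in> carrier L" "y \<in> carrier L" for x y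
    using that bound[of "x \<ominus>\<^bsub>L\<^esub> y"] by (simp add: diff dist_eq dist_norm)
  have "continuous_map mtopology euclidean \<phi>"
    unfolding continuous_map_from_metric
  proof (intro conjI ballI allI impI)
    fix a U assume a: "a \<in> carrier L" and "openin euclidean U \<and> \<phi> a \<in> U"
    then obtain e where "e > 0" "ball (\<phi> a) e \<subseteq> U" by (auto simp: open_contains_ball)
    thus "\<exists>r>0. \<forall>x. x \<in> carrier L \<and> norm_dist L N a x < r \<longrightarrow> \<phi> x \<in> U"
      using lip[OF a] by (intro exI[of _ e]) (fastforce simp: subset_iff)
  qed auto
  thus ?thesis using assms by (simp add: dual_iff topo_eq norm_topology_eq)
qed

end

lemma normed_tvs_banach: "banach_space L N \<Longrightarrow> normed_tvs L N"
  by (simp add: banach_space_def normed_tvs_def normed_tvs_axioms_def normed_space_on_def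
      normed_space_on_axioms_def vspace_def)

text \<open>
  The norm topology sees only the linear structure, so the topology stored in a space may be
  computed from the space itself instead of from its underlying module.
\<close>

lemma norm_topology_extend:
  "norm_topology (module.extend V rest) f = norm_topology V f"
proof -
  have "norm_dist (module.extend V rest) f = norm_dist V f"
    by (intro ext) (simp add: norm_dist_def a_minus_def a_inv_def m_inv_def module.extend_def)
  thus ?thesis by (simp add: norm_topology_def module.extend_def)
qed

section \<open>The space of bounded sequences\<close>

lemma linf_simps [simp]:
  "carrier linf = {x :: nat \<Rightarrow> 'a::{real_normed_field,banach}. bounded (range x)}"
  "\<zero>\<^bsub>linf\<^esub> = (\<lambda>n. 0 :: 'a)"
  "x \<oplus>\<^bsub>linf\<^esub> y = (\<lambda>n. x n + y n :: 'a)"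
  "c \<odot>\<^bsub>linf\<^esub> x = (\<lambda>n. c * x n :: 'a)"
  "topo linf = norm_topology (linf :: ('a, nat \<Rightarrow> 'a) tvs) linf_norm"
proof -
  have "topo linf = norm_topology (linf_module :: ('a, nat \<Rightarrow> 'a) module) linf_norm"
    by (simp add: linf_def module.extend_def)
  thus "topo linf = norm_topology (linf :: ('a, nat \<Rightarrow> 'a) tvs) linf_norm"
    unfolding linf_def norm_topology_extend .
qed (simp_all add: linf_def linf_module_def module.extend_def)

lemma bounded_range_scale:
  fixes x :: "nat \<Rightarrow> 'f::real_normed_field"
  assumes "bounded (range x)"
  shows "bounded (range (\<lambda>n. c * x n))"
proof -
  obtain B where "\<And>n. norm (x n) \<le> B" using assms by (auto simp: bounded_iff)
  thus ?thesis by (auto simp: bounded_iff norm_mult intro!: exI[of _ "norm c * B"] mult_left_mono)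
qed

lemma vector_space_on_linf: "vector_space_on linf"
  by (rule vector_space_onI)
     (auto simp: algebra_simps fun_eq_iff intro: bounded_plus_comp bounded_range_scale)

lemma norm_le_linf_norm:
  assumes "bounded (range x)"
  shows "norm (x n) \<le> linf_norm x"
proof -
  have "bdd_above (range (\<lambda>n. norm (x n)))"
    using assms by (auto simp: bounded_iff bdd_above_def)
  thus ?thesis unfolding linf_norm_def by (rule cSUP_upper[rotated]) simp
qed

lemma linf_norm_le: "(\<And>n. norm (x n) \<le> c) \<Longrightarrow> linf_norm x \<le> c"
  unfolding linf_norm_def by (rule cSUP_least) auto

lemma norm_on_linf: "norm_on linf linf_norm"
  unfolding norm_on_def
proof (intro conjI ballI allI)
  fix x :: "nat \<Rightarrow> 'a" assume "x \<in> carrier linf"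
  hence x: "bounded (range x)" by simp
  note le = norm_le_linf_norm[OF x]
  show "0 \<le> linf_norm x" using le[of 0] norm_ge_zero order_trans by blast
  show "linf_norm x = 0 \<longleftrightarrow> x = \<zero>\<^bsub>linf\<^esub>"
  proof
    assume "linf_norm x = 0"
    with le show "x = \<zero>\<^bsub>linf\<^esub>" by (auto simp: fun_eq_iff)
  qed (simp add: linf_norm_def)
  show "linf_norm (c \<odot>\<^bsub>linf\<^esub> x) = norm c * linf_norm x" for c
  proof (cases "c = 0")
    case False
    have "linf_norm (\<lambda>n. c * x n) \<le> norm c * linf_norm x"
      by (rule linf_norm_le) (simp add: norm_mult mult_left_mono le)
    moreover have "linf_norm x \<le> linf_norm (\<lambda>n. c * x n) / norm c"
    proof (rule linf_norm_le)
      fix n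
      have "norm (c * x n) \<le> linf_norm (\<lambda>n. c * x n)"
        using x by (intro norm_le_linf_norm bounded_range_scale)
      thus "norm (x n) \<le> linf_norm (\<lambda>n. c * x n) / norm c"
        using False by (simp add: norm_mult field_simps)
    qed
    ultimately show ?thesis using False by (simp add: field_simps)
  qed (simp add: linf_norm_def)
  fix y :: "nat \<Rightarrow> 'a" assume "y \<in> carrier linf"
  hence y: "bounded (range y)" by simp
  show "linf_norm (x \<oplus>\<^bsub>linf\<^esub> y) \<le> linf_norm x + linf_norm y"
    using le norm_le_linf_norm[OF y]
    by (auto intro!: linf_norm_le intro: norm_triangle_le add_mono)
qed

interpretation linf: normed_tvs linf linf_norm
  by unfold_locales (simp_all add: vector_space_on_linf norm_on_linf)

lemma linf_dist:
  assumes "bounded (range x)" "bounded (range y)"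
  shows "norm_dist linf linf_norm x y = linf_norm (\<lambda>n. x n - y n)"
  using assms by (simp add: linf.dist_eq a_minus_def linf.minus_eq_scale)

text \<open>
  A Cauchy sequence for the sup norm converges in every coordinate because the scalars are
  complete, and the coordinatewise limit is uniform.
\<close>

lemma mcomplete_linf: "Metric_space.mcomplete (carrier linf) (norm_dist linf linf_norm)"
  unfolding linf.mcomplete_def
proof (intro allI impI)
  fix \<sigma> :: "nat \<Rightarrow> nat \<Rightarrow> 'a" assume C: "linf.MCauchy \<sigma>"
  have "range \<sigma> \<subseteq> carrier linf" using C unfolding linf.MCauchy_def by blast
  hence b: "bounded (range (\<sigma> n))" for n by auto
  have d: "norm (\<sigma> n k - \<sigma> m k) \<le> norm_dist linf linf_norm (\<sigma> n) (\<sigma> m)" for n m k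
    unfolding linf_dist[OF b b]
    by (rule norm_le_linf_norm) (intro bounded_minus_comp b)
  have cauchy: "\<exists>M. \<forall>n\<ge>M. \<forall>m\<ge>M. \<forall>k. norm (\<sigma> n k - \<sigma> m k) < e" if "e > 0" for e
    using C d that unfolding linf.MCauchy_def by (meson le_less_trans)
  have "Cauchy (\<lambda>n. \<sigma> n k)" for k
  proof (rule CauchyI)
    fix e :: real assume "0 < e"
    from cauchy[OF this] show "\<exists>M. \<forall>m\<ge>M. \<forall>n\<ge>M. norm (\<sigma> m k - \<sigma> n k) < e" by fast
  qed
  hence "\<forall>k. \<exists>l. (\<lambda>n. \<sigma> n k) \<longlonglongrightarrow> l"
    by (simp add: Cauchy_convergent_iff convergent_def)
  then obtain l where l: "\<And>k. (\<lambda>n. \<sigma> n k) \<longlonglongrightarrow> l k" by metis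
  have close: "\<exists>M. \<forall>n\<ge>M. \<forall>k. norm (\<sigma> n k - l k) \<le> e" if e: "e > 0" for e
  proof -
    obtain M where M: "\<forall>n\<ge>M. \<forall>m\<ge>M. \<forall>k. norm (\<sigma> n k - \<sigma> m k) < e" using cauchy[OF e] by blast
    have "norm (\<sigma> n k - l k) \<le> e" if "n \<ge> M" for n k
    proof (rule Lim_norm_ubound)
      show "(\<lambda>m. \<sigma> n k - \<sigma> m k) \<longlonglongrightarrow> \<sigma> n k - l k" by (intro tendsto_intros l)
      show "\<forall>\<^sub>F m in sequentially. norm (\<sigma> n k - \<sigma> m k) \<le> e"
        using M that by (auto simp: eventually_sequentially intro!: exI[of _ M] less_imp_le)
    qed simp
    thus ?thesis by blast
  qed
  obtain M where M: "\<And>k. norm (\<sigma> M k - l k) \<le> 1" using close[of 1] by auto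
  have "bounded (range (\<lambda>k. \<sigma> M k - l k))" using M by (auto simp: bounded_iff)
  from bounded_minus_comp[OF b[of M] this] have bl: "bounded (range l)" by simp
  have "limitin linf.mtopology \<sigma> l sequentially"
    unfolding linf.limit_metric_sequentially
  proof (intro conjI allI impI)
    show "l \<in> carrier linf" using bl by simp
    fix e :: real assume e: "e > 0"
    then obtain M where M: "\<forall>n\<ge>M. \<forall>k. norm (\<sigma> n k - l k) \<le> e / 2" using close[of "e/2"] by auto
    have "norm_dist linf linf_norm (\<sigma> n) l < e" if "n \<ge> M" for n
    proof -
      have "norm_dist linf linf_norm (\<sigma> n) l \<le> e / 2"
        unfolding linf_dist[OF b bl] using M that by (intro linf_norm_le) blast
      thus ?thesis using e by simp
    qed
    thus "\<exists>M. \<forall>n\<ge>M. \<sigma> n \<in> carrier linf \<and> norm_dist linf linf_norm (\<sigma> n) l < e"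
      using b by auto
  qed
  thus "\<exists>x. limitin linf.mtopology \<sigma> x sequentially" by blast
qed

lemma banach_space_linf: "banach_space linf linf_norm"
  by (simp add: banach_space_def vector_space_on_linf norm_on_linf mcomplete_linf del: linf_simps(1))


lemma linf_coordinate_in_dual_ball:
  "(\<lambda>x\<in>carrier linf. x n) \<in> linf.dual_ball"
proof -
  have "(\<lambda>x\<in>carrier linf. x n) \<in> dual linf"
    by (rule linf.dual_if_bounded)
       (auto simp: norm_le_linf_norm bounded_range_scale intro: bounded_plus_comp)
  thus ?thesis by (simp add: linf.dual_ball_def norm_le_linf_norm)
qed

text \<open>
  The map with coordinate functionals \<open>\<xi> n\<close>, through which sequences of functionals turn into
  operators with values in \<^const>\<open>linf\<close>.
\<close>

definition seq_op :: "(nat \<Rightarrow> 'a \<Rightarrow> 'f) \<Rightarrow> 'a \<Rightarrow> nat \<Rightarrow> 'f" where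
  "seq_op \<xi> x = (\<lambda>n. \<xi> n x)"

text \<open>
  Equicontinuity at zero gives a neighbourhood of zero on which all functionals are below 1, and
  that neighbourhood absorbs \<open>x\<close> because scalar multiplication is continuous.
\<close>

lemma equicontinuous_bounded_at:
  fixes E :: "('f::{real_normed_field,banach}, 'a) tvs"
  assumes "lcs E" and \<xi>: "range \<xi> \<subseteq> dual E" and eq: "equicontinuous_set E (range \<xi>)"
    and x: "x \<in> carrier E"
  shows "bounded (range (seq_op \<xi> x))"
proof -
  have vec: "vector_space_on E" and top: "topspace (topo E) = carrier E"
    and smult: "continuous_map (prod_topology euclidean (topo E)) (topo E) (\<lambda>(c, x). c \<odot>\<^bsub>E\<^esub> x)"
    using \<open>lcs E\<close> by (auto simp: lcs_def)
  interpret vspace E by unfold_locales fact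
  have d: "\<xi> n \<in> dual E" for n using \<xi> by auto
  obtain U where U: "openin (topo E) U" "\<zero>\<^bsub>E\<^esub> \<in> U"
      "\<And>y n. y \<in> U \<Longrightarrow> norm (\<xi> n y - \<xi> n \<zero>\<^bsub>E\<^esub>) < 1"
    using eq M.zero_closed unfolding equicontinuous_set_def by (metis rangeI zero_less_one)
  have "continuous_map euclidean (prod_topology euclidean (topo E)) (\<lambda>c::'f. (c, x))"
    using x top by (simp add: continuous_map_pairwise o_def)
  from continuous_map_compose[OF this smult]
  have "continuous_map euclidean (topo E) (\<lambda>c. c \<odot>\<^bsub>E\<^esub> x)" by (simp add: o_def)
  from openin_continuous_map_preimage[OF this U(1)]
  have "open {c. c \<odot>\<^bsub>E\<^esub> x \<in> U}" by simp
  moreover have "0 \<in> {c. c \<odot>\<^bsub>E\<^esub> x \<in> U}" using U(2) x by (simp add: zero_scale)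
  ultimately obtain e where e: "e > 0" "ball 0 e \<subseteq> {c. c \<odot>\<^bsub>E\<^esub> x \<in> U}"
    unfolding open_contains_ball by blast
  define c where "c = (of_real (e / 2) :: 'f)"
  have c: "norm c = e / 2" using e(1) by (simp add: c_def del: of_real_divide)
  hence cU: "c \<odot>\<^bsub>E\<^esub> x \<in> U" using e by (auto simp: subset_iff)
  have "norm (\<xi> n x) \<le> 2 / e" for n
  proof -
    have "norm (c * \<xi> n x) < 1"
      using U(3)[OF cU, of n] d[of n] x dual_zero[OF d vec] by (simp add: dual_iff)
    thus ?thesis using c e(1) by (simp add: norm_mult field_simps)
  qed
  thus ?thesis by (auto simp: bounded_iff seq_op_def)
qed

lemma operator_seq_op:
  assumes E: "lcs E" and \<xi>: "range \<xi> \<subseteq> dual E" and eq: "equicontinuous_set E (range \<xi>)"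
  shows "operator E linf (seq_op \<xi>)"
  unfolding operator_def
proof
  have top: "topspace (topo E) = carrier E" using E by (simp add: lcs_def)
  note b = equicontinuous_bounded_at[OF E \<xi> eq]
  have d: "\<xi> n \<in> dual E" for n using \<xi> by auto
  show "linear_op E linf (seq_op \<xi>)"
    using b d by (auto simp: linear_op_def seq_op_def dual_iff)
  show "continuous_map (topo E) (topo linf) (seq_op \<xi>)"
    unfolding linf.topo_eq linf.norm_topology_eq linf.continuous_map_to_metric top
  proof (intro ballI allI impI)
    fix x and e :: real assume x: "x \<in> carrier E" and e: "0 < e"
    then obtain U where U: "openin (topo E) U" "x \<in> U"
      "\<And>y n. y \<in> U \<Longrightarrow> norm (\<xi> n y - \<xi> n x) < e / 2"
      using eq unfolding equicontinuous_set_def by (metis rangeI half_gt_zero)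
    have "seq_op \<xi> y \<in> linf.mball (seq_op \<xi> x) e" if y: "y \<in> U" for y
    proof -
      have yE: "y \<in> carrier E" using y openin_subset[OF U(1)] top by blast
      have "linf_norm (\<lambda>n. seq_op \<xi> x n - seq_op \<xi> y n) \<le> e / 2"
        using U(3)[OF y] by (intro linf_norm_le) (simp add: seq_op_def norm_minus_commute less_imp_le)
      hence "norm_dist linf linf_norm (seq_op \<xi> x) (seq_op \<xi> y) < e"
        using e by (simp add: linf_dist b x yE)
      thus ?thesis using b[OF x] b[OF yE] unfolding linf.in_mball by simp
    qed
    thus "\<exists>U. openin (topo E) U \<and> x \<in> U \<and> (\<forall>y\<in>U. seq_op \<xi> y \<in> linf.mball (seq_op \<xi> x) e)"
      using U by blast
  qed
qed

text \<open>
  The sup norm of the image of \<open>x\<close> is the supremum over \<open>n\<close> of the values \<open>\<parallel>\<xi> n x\<parallel>\<close> that the definition of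
  a p-(V) set controls.
\<close>

lemma p_convergent_seq_op:
  assumes T: "linear_op E linf (seq_op \<xi>)" and pV: "p_V_set p E (range \<xi>)"
  shows "p_convergent p E linf (seq_op \<xi>)"
  unfolding p_convergent_def
proof (intro conjI allI impI T)
  fix x assume x: "weakly_summable p E x"
  hence xE: "x n \<in> carrier E" for n by (auto simp: weakly_summable_def)
  have S: "seq_op \<xi> (x n) \<in> carrier linf" for n
    using T xE by (auto simp: linear_op_def Pi_iff simp del: linf_simps)
  have lim: "(\<lambda>n. SUP \<phi>\<in>range \<xi>. ereal (norm (\<phi> (x n)))) \<longlonglongrightarrow> 0"
    using pV x by (simp add: p_V_set_def)
  have "(\<lambda>n. linf_norm (seq_op \<xi> (x n))) \<longlonglongrightarrow> 0"
  proof (rule LIMSEQ_I)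
    fix r :: real assume r: "0 < r"
    hence "\<forall>\<^sub>F n in sequentially. (SUP \<phi>\<in>range \<xi>. ereal (norm (\<phi> (x n)))) < ereal (r / 2)"
      by (intro order_tendstoD(2)[OF lim]) simp
    then obtain M where M: "\<And>n. n \<ge> M \<Longrightarrow> (SUP \<phi>\<in>range \<xi>. ereal (norm (\<phi> (x n)))) < ereal (r / 2)"
      by (auto simp: eventually_sequentially)
    have "norm (linf_norm (seq_op \<xi> (x n)) - 0) < r" if n: "n \<ge> M" for n
    proof -
      have "norm (seq_op \<xi> (x n) k) \<le> r / 2" for k
      proof -
        have "ereal (norm (\<xi> k (x n))) \<le> (SUP \<phi>\<in>range \<xi>. ereal (norm (\<phi> (x n))))"
          by (rule SUP_upper) simp
        hence "ereal (norm (\<xi> k (x n))) < ereal (r / 2)" using M[OF n] by (rule le_less_trans)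
        thus ?thesis by (simp add: seq_op_def)
      qed
      hence "linf_norm (seq_op \<xi> (x n)) \<le> r / 2" by (rule linf_norm_le)
      thus ?thesis using r linf.norm_nonneg[OF S] by simp
    qed
    thus "\<exists>M. \<forall>n\<ge>M. norm (linf_norm (seq_op \<xi> (x n)) - 0) < r" by blast
  qed
  thus "limitin (topo linf) (\<lambda>n. seq_op \<xi> (x n)) \<zero>\<^bsub>linf\<^esub> sequentially"
    unfolding linf.topo_eq using S by (subst linf.limitin_zero_iff) auto
qed

section \<open>Isometric copies\<close>

text \<open>
  Transport of structure along an injection \<open>J\<close> with left inverse \<open>R\<close>, which serves to move a Banach
  space to another type.
\<close>

definition copy_module ::
    "('a \<Rightarrow> 'b) \<Rightarrow> ('b \<Rightarrow> 'a) \<Rightarrow> ('f::{real_normed_field,banach}, 'a) tvs \<Rightarrow> ('f, 'b) module" where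
  "copy_module J R L =
     \<lparr>carrier = J ` carrier L, mult = undefined, one = undefined, zero = J \<zero>\<^bsub>L\<^esub>,
      add = (\<lambda>x y. J (R x \<oplus>\<^bsub>L\<^esub> R y)), smult = (\<lambda>c x. J (c \<odot>\<^bsub>L\<^esub> R x))\<rparr>"

definition copy_tvs ::
    "('a \<Rightarrow> 'b) \<Rightarrow> ('b \<Rightarrow> 'a) \<Rightarrow> ('f::{real_normed_field,banach}, 'a) tvs \<Rightarrow> ('a \<Rightarrow> real) \<Rightarrow> ('f, 'b) tvs" where
  "copy_tvs J R L N = module.extend (copy_module J R L) \<lparr>topo = norm_topology (copy_module J R L) (N \<circ> R)\<rparr>"

locale isometric_copy =
  fixes L :: "('f::{real_normed_field,banach}, 'a) tvs" and N
    and J :: "'a \<Rightarrow> 'b" and R :: "'b \<Rightarrow> 'a"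
  assumes banach: "banach_space L N" and RJ [simp]: "\<And>x. R (J x) = x"
begin

abbreviation "L' \<equiv> copy_tvs J R L N"

sublocale L: normed_tvs L N by (rule normed_tvs_banach[OF banach])

lemma J_eq_iff [simp]: "J x = J y \<longleftrightarrow> x = y"
  by (metis RJ)

lemma copy_simps [simp]:
  "carrier L' = J ` carrier L"
  "\<zero>\<^bsub>L'\<^esub> = J \<zero>\<^bsub>L\<^esub>"
  "x \<oplus>\<^bsub>L'\<^esub> y = J (R x \<oplus>\<^bsub>L\<^esub> R y)"
  "c \<odot>\<^bsub>L'\<^esub> x = J (c \<odot>\<^bsub>L\<^esub> R x)"
  by (simp_all add: copy_tvs_def copy_module_def module.extend_def)

lemma topo_copy: "topo L' = norm_topology L' (N \<circ> R)"
proof -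
  have "topo L' = norm_topology (copy_module J R L) (N \<circ> R)"
    by (simp add: copy_tvs_def module.extend_def)
  thus ?thesis unfolding copy_tvs_def norm_topology_extend .
qed

lemma vector_space_on_copy: "vector_space_on L'"
  by (rule vector_space_onI)
     (auto simp: L.scale_closed L.M.a_ac L.scale_scale L.one_scale L.zero_scale
       L.smult_l_distr[simplified] L.smult_r_distr[simplified])

lemma norm_on_copy: "norm_on L' (N \<circ> R)"
  unfolding norm_on_def
  by (auto simp: L.norm_nonneg L.norm_eq_0 L.norm_add L.norm_scale)

sublocale copy: normed_tvs L' "N \<circ> R"
  by unfold_locales (rule vector_space_on_copy norm_on_copy topo_copy)+

lemma dist_copy:
  assumes "x \<in> carrier L" "y \<in> carrier L"
  shows "norm_dist L' (N \<circ> R) (J x) (J y) = norm_dist L N x y"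
  using assms
  by (simp add: copy.dist_eq L.dist_eq a_minus_def copy.minus_eq_scale L.minus_eq_scale)

lemma operator_J: "operator L L' J"
  unfolding operator_def linear_op_def L.topo_eq L.norm_topology_eq copy.topo_eq copy.norm_topology_eq
    L.metric_continuous_map[OF copy.Metric_space_axioms]
  by (auto simp: dist_copy simp del: o_apply)

lemma operator_R: "operator L' L R"
  unfolding operator_def linear_op_def L.topo_eq L.norm_topology_eq copy.topo_eq copy.norm_topology_eq
    copy.metric_continuous_map[OF L.Metric_space_axioms]
  by (auto simp: dist_copy simp del: o_apply)

lemma banach_copy: "banach_space L' (N \<circ> R)"
  unfolding banach_space_def
proof (intro conjI vector_space_on_copy norm_on_copy topo_copy)
  show "copy.mcomplete"
    unfolding copy.mcomplete_def
  proof (intro allI impI)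
    fix \<sigma> assume C: "copy.MCauchy \<sigma>"
    hence "range \<sigma> \<subseteq> carrier L'" unfolding copy.MCauchy_def by blast
    hence \<sigma>: "\<sigma> n \<in> J ` carrier L" for n by auto
    have R\<sigma>: "R (\<sigma> n) \<in> carrier L" and JR\<sigma>: "J (R (\<sigma> n)) = \<sigma> n" for n
      using \<sigma>[of n] by auto
    have "L.MCauchy (R \<circ> \<sigma>)"
      using C R\<sigma> dist_copy[OF R\<sigma> R\<sigma>] unfolding copy.MCauchy_def L.MCauchy_def JR\<sigma> by auto
    then obtain l where "limitin L.mtopology (R \<circ> \<sigma>) l sequentially"
      using banach unfolding banach_space_def L.mcomplete_def by blast
    hence "limitin (topo L') (J \<circ> (R \<circ> \<sigma>)) (J l) sequentially"
      using operator_J by (intro continuous_map_limit[of "topo L"])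
        (auto simp: operator_def L.topo_eq L.norm_topology_eq)
    moreover have "J \<circ> (R \<circ> \<sigma>) = \<sigma>" by (simp add: fun_eq_iff JR\<sigma>)
    ultimately show "\<exists>x. limitin copy.mtopology \<sigma> x sequentially"
      by (auto simp: copy.topo_eq copy.norm_topology_eq)
  qed
qed

text \<open>
  The adjoint of an isometry maps dual ball to dual ball.
\<close>

lemma dual_ball_copy:
  assumes "\<phi> \<in> L.dual_ball"
  shows "(\<lambda>y\<in>carrier L'. \<phi> (R y)) \<in> copy.dual_ball"
proof -
  have "(\<lambda>y\<in>carrier L'. \<phi> (R y)) \<in> dual L'"
    using adjoint_in_dual[OF copy.topspace_eq vector_space_on_copy operator_R] assms
    by (simp add: adjoint_op_def L.dual_ball_def del: copy_simps)
  thus ?thesis using assms by (auto simp: copy.dual_ball_def L.dual_ball_def)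
qed

lemma weakly_compact_op_copy_iff:
  "weakly_compact_op E L' (J \<circ> T) \<longleftrightarrow> weakly_compact_op E L T"
proof
  assume "weakly_compact_op E L' (J \<circ> T)"
  hence "weakly_compact_op E L (R \<circ> (J \<circ> T))"
    by (rule weakly_compact_op_comp_iso[OF _ operator_R operator_J])
      (auto simp: copy.topspace_eq L.topspace_eq vector_space_on_copy L.vector_space)
  thus "weakly_compact_op E L T" by (simp add: o_def)
next
  assume "weakly_compact_op E L T"
  thus "weakly_compact_op E L' (J \<circ> T)"
    by (rule weakly_compact_op_comp_iso[OF _ operator_J operator_R])
      (auto simp: copy.topspace_eq L.topspace_eq vector_space_on_copy L.vector_space)
qed

end

section \<open>Sets of type p-(V) and weakly compact operators\<close>

lemma p_V_set_subset:
  assumes "p_V_set p E B" and "A \<subseteq> B" and "A \<noteq> {}"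
  shows "p_V_set p E A"
  unfolding p_V_set_def
proof (intro conjI allI impI)
  fix x assume "weakly_summable p E x"
  hence lim: "(\<lambda>n. SUP \<phi>\<in>B. ereal (norm (\<phi> (x n)))) \<longlonglongrightarrow> 0" using assms(1) by (simp add: p_V_set_def)
  show "(\<lambda>n. SUP \<phi>\<in>A. ereal (norm (\<phi> (x n)))) \<longlonglongrightarrow> 0"
  proof (rule tendsto_sandwich[OF _ _ tendsto_const lim])
    show "\<forall>\<^sub>F n in sequentially. 0 \<le> (SUP \<phi>\<in>A. ereal (norm (\<phi> (x n))))"
    proof (intro always_eventually allI)
      fix n
      obtain \<phi> where "\<phi> \<in> A" using assms(3) by blast
      thus "0 \<le> (SUP \<phi>\<in>A. ereal (norm (\<phi> (x n))))" by (rule SUP_upper2) simp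
    qed
    show "\<forall>\<^sub>F n in sequentially. (SUP \<phi>\<in>A. ereal (norm (\<phi> (x n)))) \<le> (SUP \<phi>\<in>B. ereal (norm (\<phi> (x n))))"
      using assms(2) by (auto intro!: always_eventually SUP_subset_mono)
  qed
qed (use assms in \<open>auto simp: p_V_set_def\<close>)

text \<open>
  On the dual ball \<open>\<parallel>\<phi> (T (x n))\<parallel> \<le> N (T (x n))\<close>, a bound that does not depend on \<open>\<phi>\<close> and tends to
  zero when \<open>T\<close> is p-convergent.
\<close>

lemma p_V_set_adjoint_dual_ball:
  assumes E: "lcs E" and L: "normed_tvs L N" and T: "operator E L T" and conv: "p_convergent p E L T"
  shows "p_V_set p E (adjoint_op E T ` normed_tvs.dual_ball L N)"
proof -
  interpret L: normed_tvs L N by fact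
  have top: "topspace (topo E) = carrier E" and vec: "vector_space_on E"
    using E by (auto simp: lcs_def)
  have TL: "T x \<in> carrier L" if "x \<in> carrier E" for x
    using T that by (auto simp: operator_def linear_op_def)
  have z: "(\<lambda>x\<in>carrier L. 0) \<in> L.dual_ball"
    using zero_functional_in_dual[OF L.topspace_eq L.vector_space]
    by (simp add: L.dual_ball_def L.norm_nonneg)
  show ?thesis
    unfolding p_V_set_def
  proof (intro conjI allI impI)
    show "adjoint_op E T ` L.dual_ball \<noteq> {}" using z by blast
    show "adjoint_op E T ` L.dual_ball \<subseteq> dual E"
      using adjoint_in_dual[OF top vec T] by (auto simp: L.dual_ball_def)
    fix x assume x: "weakly_summable p E x"
    hence xE: "x n \<in> carrier E" for n by (auto simp: weakly_summable_def)
    have "limitin (norm_topology L N) (\<lambda>n. T (x n)) \<zero>\<^bsub>L\<^esub> sequentially"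
      using conv x by (simp add: p_convergent_def L.topo_eq)
    hence lim: "(\<lambda>n. N (T (x n))) \<longlonglongrightarrow> 0"
      using TL xE by (subst (asm) L.limitin_zero_iff) auto
    show "(\<lambda>n. SUP \<phi>\<in>adjoint_op E T ` L.dual_ball. ereal (norm (\<phi> (x n)))) \<longlonglongrightarrow> 0"
    proof (rule tendsto_sandwich[OF _ _ tendsto_const])
      show "(\<lambda>n. ereal (N (T (x n)))) \<longlonglongrightarrow> 0"
        using lim by (simp add: zero_ereal_def)
      show "\<forall>\<^sub>F n in sequentially. 0 \<le> (SUP \<phi>\<in>adjoint_op E T ` L.dual_ball. ereal (norm (\<phi> (x n))))"
        using z by (intro always_eventually allI) (rule SUP_upper2, blast, simp)
      show "\<forall>\<^sub>F n in sequentially. (SUP \<phi>\<in>adjoint_op E T ` L.dual_ball. ereal (norm (\<phi> (x n)))) \<le> ereal (N (T (x n)))"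
        using TL xE by (auto intro!: always_eventually SUP_least simp: adjoint_op_def L.dual_ball_def)
    qed
  qed
qed

text \<open>
  The implication from (iii) to (i): the dual ball witnesses weak sequential compactness of the
  adjoint.
\<close>

lemma property_sV_imp_weakly_compact:
  fixes E :: "('f::{real_normed_field,banach}, 'a) tvs" and L :: "('f, 'u) tvs"
  assumes E: "lcs E" and G: "seq_gantmacher TYPE('u) E" and sV: "property_sV p E"
    and L: "banach_space L N" and T: "operator E L T" and conv: "p_convergent p E L T"
  shows "weakly_compact_op E L T"
proof -
  interpret L: normed_tvs L N by (rule normed_tvs_banach[OF L])
  have top: "topspace (topo E) = carrier E" and vec: "vector_space_on E"
    using E by (auto simp: lcs_def)
  have "p_V_set p E (adjoint_op E T ` L.dual_ball)"
    by (rule p_V_set_adjoint_dual_ball[OF E L.normed_tvs_axioms T conv])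
  hence "rel_weakly_seq_compact (strong_dual E) (adjoint_op E T ` L.dual_ball)"
    using sV by (simp add: property_sV_def)
  hence "weakly_seq_compact_op (strong_dual L) (strong_dual E) (adjoint_op E T)"
    using operator_adjoint[OF T top vec L.topspace_eq L.vector_space] L.zero_nhd_dual_ball
    by (auto simp: weakly_seq_compact_op_def)
  thus ?thesis using G L T unfolding seq_gantmacher_def by blast
qed

text \<open>
  The injection along which the bounded sequences are copied; the component \<open>undefined\<close> only fills
  the place that the type reserves for an element of the locally convex space.
\<close>

definition univ_emb :: "(nat \<Rightarrow> 'f) \<Rightarrow> ('f, 'a, 'l) banach_univ" where
  "univ_emb x = Inl (\<lambda>n. (undefined, x n))"

definition univ_proj :: "('f, 'a, 'l) banach_univ \<Rightarrow> nat \<Rightarrow> 'f" where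
  "univ_proj y = (case y of Inl f \<Rightarrow> snd \<circ> f | Inr _ \<Rightarrow> undefined)"

interpretation emb: isometric_copy linf linf_norm univ_emb univ_proj
  by unfold_locales (simp_all add: banach_space_linf univ_emb_def univ_proj_def fun_eq_iff)

text \<open>
  The implication from (ii) to (iii): the members of a sequence in a p-(V) set are the images
  of the coordinate functionals under the adjoint of the operator that the sequence defines.
\<close>

lemma weakly_compact_imp_property_sV:
  fixes E :: "('f::{real_normed_field,banach}, 'a) tvs"
  assumes E: "lcs E" and bar: "linf_Vp_barrelled p E"
    and G: "seq_gantmacher TYPE(('f, 'a, 'l) banach_univ) E"
    and wc: "\<forall>T. operator E linf T \<and> p_convergent p E linf T \<longrightarrow> weakly_compact_op E linf T"
  shows "property_sV p E"
  unfolding property_sV_def rel_weakly_seq_compact_def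
proof (intro allI impI conjI)
  have top: "topspace (topo E) = carrier E" and vec: "vector_space_on E"
    using E by (auto simp: lcs_def)
  fix B assume B: "p_V_set p E B"
  thus "B \<subseteq> carrier (strong_dual E)" by (simp add: p_V_set_def)
  fix \<xi> :: "nat \<Rightarrow> 'a \<Rightarrow> 'f" assume \<xi>B: "range \<xi> \<subseteq> B"
  have pV: "p_V_set p E (range \<xi>)" using p_V_set_subset[OF B \<xi>B] by simp
  hence \<xi>: "range \<xi> \<subseteq> dual E" and eq: "equicontinuous_set E (range \<xi>)"
    using bar by (auto simp: p_V_set_def linf_Vp_barrelled_def)
  let ?T = "seq_op \<xi>"
  let ?J = "univ_emb :: _ \<Rightarrow> ('f, 'a, 'l) banach_univ"
  let ?R = "univ_proj :: ('f, 'a, 'l) banach_univ \<Rightarrow> _"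
  let ?L = "copy_tvs ?J ?R linf linf_norm"
  let ?S = "?J \<circ> ?T"
  have T: "operator E linf ?T" by (rule operator_seq_op[OF E \<xi> eq])
  have "p_convergent p E linf ?T"
    using T pV by (intro p_convergent_seq_op) (simp_all add: operator_def)
  hence "weakly_compact_op E linf ?T" using wc T by blast
  hence "weakly_compact_op E ?L ?S" by (simp add: emb.weakly_compact_op_copy_iff)
  moreover have S: "operator E ?L ?S" by (rule operator_comp[OF T emb.operator_J])
  ultimately have "weakly_seq_compact_op (strong_dual ?L) (strong_dual E) (adjoint_op E ?S)"
    using G emb.banach_copy unfolding seq_gantmacher_def by blast
  then obtain U where U: "zero_nhd (strong_dual ?L) U"
    and A: "rel_weakly_seq_compact (strong_dual E) (adjoint_op E ?S ` U)"
    by (auto simp: weakly_seq_compact_op_def)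
  obtain c :: 'f where c: "c \<noteq> 0"
    and cU: "\<And>\<phi>. \<phi> \<in> emb.copy.dual_ball \<Longrightarrow> (\<lambda>x\<in>carrier ?L. c * \<phi> x) \<in> U"
    using emb.copy.dual_ball_scale_in_zero_nhd[OF U] by blast
  have dE: "\<xi> n \<in> dual E" for n using \<xi> by auto
  have "c \<odot>\<^bsub>strong_dual E\<^esub> \<xi> n \<in> adjoint_op E ?S ` U" for n
  proof
    let ?\<phi> = "\<lambda>y\<in>carrier ?L. (\<lambda>x\<in>carrier linf. x n) (?R y)"
    show "(\<lambda>y\<in>carrier ?L. c * ?\<phi> y) \<in> U"
      by (rule cU[OF emb.dual_ball_copy[OF linf_coordinate_in_dual_ball]])
    have "?T x \<in> carrier linf" if "x \<in> carrier E" for x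
      using T that by (auto simp: operator_def linear_op_def simp del: linf_simps)
    thus "c \<odot>\<^bsub>strong_dual E\<^esub> \<xi> n = adjoint_op E ?S (\<lambda>y\<in>carrier ?L. c * ?\<phi> y)"
      by (auto simp: adjoint_op_def fun_eq_iff seq_op_def simp del: linf_simps)
  qed
  thus "\<exists>l\<in>carrier (strong_dual E). \<exists>r::nat \<Rightarrow> nat. strict_mono r \<and>
           limitin (weak_topology (strong_dual E)) (\<xi> \<circ> r) l sequentially"
    using dE vector_space_on_strong_dual[OF top vec]
    by (intro rel_weakly_seq_compact_unscale[OF _ _ A c]) (simp_all add: topspace_strong_topology)
qed

theorem theorem15p15:
  fixes E :: "('f::{real_normed_field,banach}, 'a) tvs" and p :: ereal
  assumes "1 \<le> p"
    and "lcs E"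
    and "linf_Vp_barrelled p E"
    and "seq_gantmacher TYPE(('f, 'a, 'l) banach_univ) E"
  shows "((\<forall>(L :: ('f, ('f, 'a, 'l) banach_univ) tvs) N. banach_space L N \<longrightarrow>
             (\<forall>T. operator E L T \<and> p_convergent p E L T \<longrightarrow> weakly_compact_op E L T))
          \<longleftrightarrow>
          (\<forall>T. operator E linf T \<and> p_convergent p E linf T \<longrightarrow> weakly_compact_op E linf T))
       \<and> ((\<forall>T. operator E linf T \<and> p_convergent p E linf T \<longrightarrow> weakly_compact_op E linf T)
          \<longleftrightarrow>
          property_sV p E)"
    (is "(?i \<longleftrightarrow> ?ii) \<and> (?ii \<longleftrightarrow> ?iii)")
proof -
  let ?J = "univ_emb :: _ \<Rightarrow> ('f, 'a, 'l) banach_univ"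
  let ?R = "univ_proj :: ('f, 'a, 'l) banach_univ \<Rightarrow> _"
  let ?L = "copy_tvs ?J ?R linf linf_norm"
  have "?ii" if i: ?i
  proof (intro allI impI)
    fix T assume T: "operator E linf T \<and> p_convergent p E linf T"
    have "operator E ?L (?J \<circ> T)"
      using T operator_comp[OF _ emb.operator_J] by blast
    moreover have "p_convergent p E ?L (?J \<circ> T)"
      using T p_convergent_comp[OF _ emb.operator_J vector_space_on_linf emb.vector_space_on_copy]
      by blast
    ultimately have "weakly_compact_op E ?L (?J \<circ> T)" using i emb.banach_copy by blast
    thus "weakly_compact_op E linf T" by (simp add: emb.weakly_compact_op_copy_iff)
  qed
  moreover have ?iii if ?ii
    using weakly_compact_imp_property_sV[OF assms(2-4)] that by blast
  moreover have ?i if ?iii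
    using property_sV_imp_weakly_compact[OF assms(2,4) that] by blast
  ultimately show ?thesis by blast
qed

end
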